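(* Let $k$ be a field, let $N\ge 2$ be an integer, let $E$ be a finite-dimensional $k$-vector space, let $R\subset E^{\otimes N}$ be a linear subspace, and let $\mathcal{A}=A(E,R)$ be the corresponding homogeneous algebra of degree $N$. Let $\alpha$ be an automorphism of the graded algebra $\mathcal{A}$, and let $\mathcal{A}^\alpha$ be the semi-cross product of $\mathcal{A}$ by $\alpha$. Then $\mathcal{A}$ is Koszul if and only if $\mathcal{A}^\alpha$ is Koszul.
   Context: All tensor products are over $k$. For a finite-dimensional vector space $E$ and a subspace $R\subset E^{\otimes N}$, the homogeneous algebra of degree $N$ (or $N$-homogeneous algebra) $A(E,R)$ is $T(E)/I(R)$, where $T(E)$ is the tensor algebra and $I(R)$ is the two-sided ideal generated by $R$; it is graded with $E$ in degree $1$. An automorphism $\alpha$ of the graded algebra $\mathcal{A}=A(E,R)$ is given by a linear automorphism of $E$, still denoted $\alpha$, whose canonical extension to an algebra automorphism of $T(E)$ (also denoted $\alpha$) satisfies $\alpha(R)=R$. The semi-cross product $\mathcal{A}^\alpha$ is the graded vector space underlying $\mathcal{A}$ equipped with the product $x\cdot y=x\,\alpha^{|x|}(y)$ for homogeneous $x,y$, where $|x|$ is the degree of $x$ and the product on the right-hand side is that of $\mathcal{A}$. It is an associative graded algebra with the same unit as $\mathcal{A}$. It is again a homogeneous algebra of degree $N$, namely $\mathcal{A}^\alpha=A(E,\theta_N^{-1}(R))$, where $\theta_N:E^{\otimes N}\to E^{\otimes N}$ is $\theta_N(x_0\otimes x_1\otimes\cdots\otimes x_{N-1})=x_0\otimes\alpha(x_1)\otimes\cdots\otimes\alpha^{N-1}(x_{N-1})$.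 Koszul property. For an $N$-homogeneous algebra $\mathcal{A}=A(E,R)$, let $\mathcal{A}^!=A(E^*,R^\perp)$, where $R^\perp\subset (E^* )^{\otimes N}=(E^{\otimes N})^*$ is the annihilator of $R$, and let $\mathcal{A}^{!*}_i$ be the dual vector space of $\mathcal{A}^!_i$. It is naturally the subspace of $E^{\otimes i}$ given by $\mathcal{A}^{!*}_i=E^{\otimes i}$ for $i<N$ and $\mathcal{A}^{!*}_i=\bigcap_{r+s=i-N}E^{\otimes r}\otimes R\otimes E^{\otimes s}$ for $i\ge N$. Let $d:\mathcal{A}\otimes\mathcal{A}^{!*}_{i+1}\to\mathcal{A}\otimes\mathcal{A}^{!*}_i$ be the left $\mathcal{A}$-linear map induced by $a\otimes(e_0\otimes e_1\otimes\cdots\otimes e_i)\mapsto ae_0\otimes(e_1\otimes\cdots\otimes e_i)$; one has $d^N=0$. The Koszul complex $\mathcal{C}$ of $\mathcal{A}$ is the chain complex of left $\mathcal{A}$-modules with $\mathcal{C}_{2p}=\mathcal{A}\otimes\mathcal{A}^{!*}_{pN}$ and $\mathcal{C}_{2p+1}=\mathcal{A}\otimes\mathcal{A}^{!*}_{pN+1}$ for $p\ge 0$, with differentials $d:\mathcal{C}_{2p+1}\to\mathcal{C}_{2p}$ and $d^{N-1}:\mathcal{C}_{2p+2}\to\mathcal{C}_{2p+1}$. The algebra $\mathcal{A}$ is called Koszul (of Koszul type) if $\mathcal{C}$ is acyclic in strictly positive degrees. *)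

theory Defs
  imports Complex_Main "HOL-Algebra.QuotRing" "HOL-Algebra.Module" "HOL-Library.Poly_Mapping"
begin

section \<open>Vector spaces and graded algebras with carriers\<close>

text \<open>
  The scalars form a type \<open>'k\<close> of class \<^class>\<open>field\<close>. Vector spaces and algebras that arise as
  quotients are records of type \<^type>\<open>module\<close>; a graded algebra also carries the family of its
  homogeneous components.
\<close>

definition scalars :: "'k::field ring" where
  "scalars = \<lparr>carrier = UNIV, mult = (*), one = 1, zero = 0, add = (+)\<rparr>"

abbreviation linear_subspace :: "'a set \<Rightarrow> ('k::field, 'a, 'm) module_scheme \<Rightarrow> bool" where
  "linear_subspace U V \<equiv> submodule U scalars V"

definition span_in :: "('k::field, 'a, 'm) module_scheme \<Rightarrow> 'a set \<Rightarrow> 'a set" where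
  "span_in V S = \<Inter> {U. linear_subspace U V \<and> S \<subseteq> U}"

definition linear_maps ::
    "('k::field, 'a, 'm) module_scheme \<Rightarrow> ('k, 'b, 'n) module_scheme \<Rightarrow> ('a \<Rightarrow> 'b) set" where
  "linear_maps V W = {h \<in> carrier V \<rightarrow> carrier W.
     (\<forall>x\<in>carrier V. \<forall>y\<in>carrier V. h (x \<oplus>\<^bsub>V\<^esub> y) = h x \<oplus>\<^bsub>W\<^esub> h y) \<and>
     (\<forall>c. \<forall>x\<in>carrier V. h (c \<odot>\<^bsub>V\<^esub> x) = c \<odot>\<^bsub>W\<^esub> h x)}"

record ('k, 'a) graded_algebra = "('k, 'a) module" +
  grade :: "nat \<Rightarrow> 'a set"

definition graded_algebra_isos ::
    "('k::field, 'a, 'm) graded_algebra_scheme \<Rightarrow> ('k, 'b, 'n) graded_algebra_scheme \<Rightarrow> ('a \<Rightarrow> 'b) set" where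
  "graded_algebra_isos A B =
     {h \<in> ring_iso A B. h \<in> linear_maps A B \<and> (\<forall>n. h ` grade A n = grade B n)}"

text \<open>
  Quotients are sets of cosets, as for \<^const>\<open>FactRing\<close>. The product of \<open>quotient_module V U\<close> is
  meaningful only when \<open>U\<close> is an ideal of an algebra.
\<close>

definition quotient_module :: "('k::field, 'a, 'm) module_scheme \<Rightarrow> 'a set \<Rightarrow> ('k, 'a set) module" where
  "quotient_module V U = ring.extend (V Quot U)
     (module.fields (\<lambda>c X. \<Union>x\<in>X. U +>\<^bsub>V\<^esub> (c \<odot>\<^bsub>V\<^esub> x)))"

definition quotient_algebra ::
    "('k::field, 'a, 'm) graded_algebra_scheme \<Rightarrow> 'a set \<Rightarrow> ('k, 'a set) graded_algebra" where
  "quotient_algebra A I = module.extend (quotient_module A I)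
     (graded_algebra.fields (\<lambda>n. (\<lambda>x. I +>\<^bsub>A\<^esub> x) ` grade A n))"


section \<open>The tensor product of two vector spaces\<close>

text \<open>
  The quotient of the vector space freely generated by all pairs by the bilinearity relations.
  Only the vector space structure matters; the fields for product and unit are dummies.
\<close>

definition free_space :: "'x set \<Rightarrow> ('k::field, 'x \<Rightarrow>\<^sub>0 'k) module" where
  "free_space X = \<lparr>carrier = {p. Poly_Mapping.keys p \<subseteq> X}, mult = (\<lambda>_ _. 0), one = 0,
     zero = 0, add = (+), smult = (\<lambda>c. Poly_Mapping.map ((*) c))\<rparr>"

definition bilinear_relations ::
    "('k::field, 'a, 'm) module_scheme \<Rightarrow> ('k, 'b, 'n) module_scheme \<Rightarrow> (('a \<times> 'b) \<Rightarrow>\<^sub>0 'k) set" where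
  "bilinear_relations V W =
     {Poly_Mapping.single (x \<oplus>\<^bsub>V\<^esub> y, w) 1 - Poly_Mapping.single (x, w) 1 - Poly_Mapping.single (y, w) 1
       | x y w. x \<in> carrier V \<and> y \<in> carrier V \<and> w \<in> carrier W} \<union>
     {Poly_Mapping.single (x, w \<oplus>\<^bsub>W\<^esub> z) 1 - Poly_Mapping.single (x, w) 1 - Poly_Mapping.single (x, z) 1
       | x w z. x \<in> carrier V \<and> w \<in> carrier W \<and> z \<in> carrier W} \<union>
     {Poly_Mapping.single (c \<odot>\<^bsub>V\<^esub> x, w) 1 - Poly_Mapping.single (x, w) c
       | c x w. x \<in> carrier V \<and> w \<in> carrier W} \<union>
     {Poly_Mapping.single (x, c \<odot>\<^bsub>W\<^esub> w) 1 - Poly_Mapping.single (x, w) c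
       | c x w. x \<in> carrier V \<and> w \<in> carrier W}"

definition bilinear_kernel ::
    "('k::field, 'a, 'm) module_scheme \<Rightarrow> ('k, 'b, 'n) module_scheme \<Rightarrow> (('a \<times> 'b) \<Rightarrow>\<^sub>0 'k) set" where
  "bilinear_kernel V W = span_in (free_space (carrier V \<times> carrier W)) (bilinear_relations V W)"

definition tensor_product ::
    "('k::field, 'a, 'm) module_scheme \<Rightarrow> ('k, 'b, 'n) module_scheme
      \<Rightarrow> ('k, (('a \<times> 'b) \<Rightarrow>\<^sub>0 'k) set) module" where
  "tensor_product V W =
     quotient_module (free_space (carrier V \<times> carrier W)) (bilinear_kernel V W)"

definition pure_tensor ::
    "('k::field, 'a, 'm) module_scheme \<Rightarrow> ('k, 'b, 'n) module_scheme \<Rightarrow> 'a \<Rightarrow> 'b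
      \<Rightarrow> (('a \<times> 'b) \<Rightarrow>\<^sub>0 'k) set" where
  "pure_tensor V W v w =
     bilinear_kernel V W +>\<^bsub>free_space (carrier V \<times> carrier W)\<^esub> Poly_Mapping.single (v, w) 1"


section \<open>The tensor algebra\<close>

text \<open>
  Words form the free monoid, so that \<open>'v list \<Rightarrow>\<^sub>0 'k\<close> with the convolution product of
  \<^theory>\<open>HOL-Library.Poly_Mapping\<close> is the free associative unital algebra on the set \<open>'v\<close>.
\<close>

instantiation list :: (type) monoid_add
begin

definition zero_list :: "'a list" where "zero_list = []"

definition plus_list :: "'a list \<Rightarrow> 'a list \<Rightarrow> 'a list" where "plus_list = (@)"

instance by standard (simp_all add: zero_list_def plus_list_def)

end

definition free_algebra :: "('k::field, 'v list \<Rightarrow>\<^sub>0 'k) graded_algebra" where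
  "free_algebra = \<lparr>carrier = UNIV, mult = (*), one = 1, zero = 0, add = (+),
     smult = (\<lambda>c. Poly_Mapping.map ((*) c)),
     grade = (\<lambda>n. {p. \<forall>w\<in>Poly_Mapping.keys p. length w = n})\<rparr>"

text \<open>
  The vector space \<open>E\<close> is the type \<open>'v\<close> with scalar multiplication \<open>scale\<close>. Its tensor algebra is
  the free algebra on the set \<open>'v\<close> modulo the linear relations of \<open>E\<close> in degree one; the component
  of degree \<open>n\<close> of the quotient is the tensor power of \<open>E\<close> of order \<open>n\<close>.
\<close>

definition linear_relations ::
    "('k::field \<Rightarrow> 'v::ab_group_add \<Rightarrow> 'v) \<Rightarrow> ('v list \<Rightarrow>\<^sub>0 'k) set" where
  "linear_relations scale =
     {Poly_Mapping.single [x + y] 1 - Poly_Mapping.single [x] 1 - Poly_Mapping.single [y] 1 | x y. True} \<union>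
     {Poly_Mapping.single [scale c x] 1 - Poly_Mapping.single [x] c | c x. True}"

type_synonym ('k, 'v) tensor = "('v list \<Rightarrow>\<^sub>0 'k) set"

definition tensor_algebra ::
    "('k::field \<Rightarrow> 'v::ab_group_add \<Rightarrow> 'v) \<Rightarrow> ('k, ('k, 'v) tensor) graded_algebra" where
  "tensor_algebra scale =
     quotient_algebra free_algebra (Idl\<^bsub>free_algebra\<^esub> (linear_relations scale))"

abbreviation tensor_power ::
    "('k::field \<Rightarrow> 'v::ab_group_add \<Rightarrow> 'v) \<Rightarrow> nat \<Rightarrow> ('k, 'v) tensor set" where
  "tensor_power scale n \<equiv> grade (tensor_algebra scale) n"

definition tensor_incl :: "('k::field \<Rightarrow> 'v::ab_group_add \<Rightarrow> 'v) \<Rightarrow> 'v \<Rightarrow> ('k, 'v) tensor" where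
  "tensor_incl scale e =
     Idl\<^bsub>free_algebra\<^esub> (linear_relations scale) +>\<^bsub>free_algebra\<^esub> Poly_Mapping.single [e] 1"


section \<open>Homogeneous algebras and semi-cross products\<close>

definition homogeneous_algebra ::
    "('k::field \<Rightarrow> 'v::ab_group_add \<Rightarrow> 'v) \<Rightarrow> ('k, 'v) tensor set
      \<Rightarrow> ('k, ('k, 'v) tensor set) graded_algebra" where
  "homogeneous_algebra scale R =
     quotient_algebra (tensor_algebra scale) (Idl\<^bsub>tensor_algebra scale\<^esub> R)"

definition generator ::
    "('k::field \<Rightarrow> 'v::ab_group_add \<Rightarrow> 'v) \<Rightarrow> ('k, 'v) tensor set \<Rightarrow> 'v \<Rightarrow> ('k, 'v) tensor set" where
  "generator scale R e =
     (Idl\<^bsub>tensor_algebra scale\<^esub> R) +>\<^bsub>tensor_algebra scale\<^esub> tensor_incl scale e"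

definition homogeneous_component ::
    "('k::field, 'a, 'm) graded_algebra_scheme \<Rightarrow> 'a \<Rightarrow> nat \<Rightarrow> 'a" where
  "homogeneous_component A x = (SOME c. (\<forall>n. c n \<in> grade A n) \<and> finite {n. c n \<noteq> \<zero>\<^bsub>A\<^esub>} \<and>
     x = (\<Oplus>\<^bsub>A\<^esub>n\<in>{n. c n \<noteq> \<zero>\<^bsub>A\<^esub>}. c n))"

text \<open>The product is \<open>x \<alpha>\<^sup>n(y)\<close> for \<open>x\<close> of degree \<open>n\<close>, extended linearly in \<open>x\<close>.\<close>

definition semi_cross_product ::
    "('k::field, 'a) graded_algebra \<Rightarrow> ('a \<Rightarrow> 'a) \<Rightarrow> ('k, 'a) graded_algebra" where
  "semi_cross_product A \<alpha> = A\<lparr>mult := \<lambda>x y.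
     \<Oplus>\<^bsub>A\<^esub>n\<in>{n. homogeneous_component A x n \<noteq> \<zero>\<^bsub>A\<^esub>}. homogeneous_component A x n \<otimes>\<^bsub>A\<^esub> (\<alpha> ^^ n) y\<rparr>"


section \<open>The Koszul complex\<close>

text \<open>
  The dual of the component of degree \<open>i\<close> of the Koszul dual algebra, as a subspace of the tensor
  power of order \<open>i\<close>.
\<close>

definition koszul_dual_space ::
    "('k::field \<Rightarrow> 'v::ab_group_add \<Rightarrow> 'v) \<Rightarrow> nat \<Rightarrow> ('k, 'v) tensor set \<Rightarrow> nat \<Rightarrow> ('k, 'v) tensor set" where
  "koszul_dual_space scale N R i =
     (if i < N then tensor_power scale i
      else (\<Inter>(r, s) \<in> {(r, s). r + s = i - N}. span_in (tensor_algebra scale)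
        {u \<otimes>\<^bsub>tensor_algebra scale\<^esub> \<rho> \<otimes>\<^bsub>tensor_algebra scale\<^esub> v | u \<rho> v.
           u \<in> tensor_power scale r \<and> \<rho> \<in> R \<and> v \<in> tensor_power scale s}))"

text \<open>
  All terms of the Koszul complex are realised inside \<open>A \<otimes> T(E)\<close>: since the scalars form a field,
  \<open>A \<otimes> W\<close> is canonically the subspace spanned by the \<open>a \<otimes> w\<close> with \<open>w \<in> W\<close>. The map \<open>d\<close> is
  determined on \<open>A \<otimes> T(E)\<close> by its values \<open>a \<otimes> (e t) \<mapsto> a e \<otimes> t\<close> and the convention that it
  vanishes on the summand \<open>A \<otimes> k\<close>, which it never meets in the complex.
\<close>

abbreviation koszul_ambient ::
    "('k::field \<Rightarrow> 'v::ab_group_add \<Rightarrow> 'v) \<Rightarrow> ('k, 'v) tensor set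
      \<Rightarrow> ('k, ((('k, 'v) tensor set \<times> ('k, 'v) tensor) \<Rightarrow>\<^sub>0 'k) set) module" where
  "koszul_ambient scale R \<equiv> tensor_product (homogeneous_algebra scale R) (tensor_algebra scale)"

abbreviation koszul_tensor ::
    "('k::field \<Rightarrow> 'v::ab_group_add \<Rightarrow> 'v) \<Rightarrow> ('k, 'v) tensor set \<Rightarrow> ('k, 'v) tensor set \<Rightarrow> ('k, 'v) tensor
      \<Rightarrow> ((('k, 'v) tensor set \<times> ('k, 'v) tensor) \<Rightarrow>\<^sub>0 'k) set" where
  "koszul_tensor scale R \<equiv> pure_tensor (homogeneous_algebra scale R) (tensor_algebra scale)"

definition koszul_d ::
    "('k::field \<Rightarrow> 'v::ab_group_add \<Rightarrow> 'v) \<Rightarrow> ('k, 'v) tensor set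
      \<Rightarrow> ((('k, 'v) tensor set \<times> ('k, 'v) tensor) \<Rightarrow>\<^sub>0 'k) set
      \<Rightarrow> ((('k, 'v) tensor set \<times> ('k, 'v) tensor) \<Rightarrow>\<^sub>0 'k) set" where
  "koszul_d scale R = (SOME D.
     D \<in> linear_maps (koszul_ambient scale R) (koszul_ambient scale R) \<and>
     (\<forall>a\<in>carrier (homogeneous_algebra scale R).
        D (koszul_tensor scale R a \<one>\<^bsub>tensor_algebra scale\<^esub>) = \<zero>\<^bsub>koszul_ambient scale R\<^esub> \<and>
        (\<forall>e. \<forall>t\<in>carrier (tensor_algebra scale).
           D (koszul_tensor scale R a (tensor_incl scale e \<otimes>\<^bsub>tensor_algebra scale\<^esub> t)) =
             koszul_tensor scale R (a \<otimes>\<^bsub>homogeneous_algebra scale R\<^esub> generator scale R e) t)))"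

definition koszul_degree :: "nat \<Rightarrow> nat \<Rightarrow> nat" where
  "koszul_degree N j = (if even j then (j div 2) * N else (j div 2) * N + 1)"

definition koszul_chains ::
    "('k::field \<Rightarrow> 'v::ab_group_add \<Rightarrow> 'v) \<Rightarrow> nat \<Rightarrow> ('k, 'v) tensor set \<Rightarrow> nat
      \<Rightarrow> ((('k, 'v) tensor set \<times> ('k, 'v) tensor) \<Rightarrow>\<^sub>0 'k) set set" where
  "koszul_chains scale N R j = span_in (koszul_ambient scale R)
     {koszul_tensor scale R a w | a w. a \<in> carrier (homogeneous_algebra scale R) \<and>
        w \<in> koszul_dual_space scale N R (koszul_degree N j)}"

text \<open>The differential from chain degree \<open>j\<close> to chain degree \<open>j - 1\<close>, for \<open>j \<ge> 1\<close>.\<close>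

definition koszul_differential ::
    "('k::field \<Rightarrow> 'v::ab_group_add \<Rightarrow> 'v) \<Rightarrow> nat \<Rightarrow> ('k, 'v) tensor set \<Rightarrow> nat
      \<Rightarrow> ((('k, 'v) tensor set \<times> ('k, 'v) tensor) \<Rightarrow>\<^sub>0 'k) set
      \<Rightarrow> ((('k, 'v) tensor set \<times> ('k, 'v) tensor) \<Rightarrow>\<^sub>0 'k) set" where
  "koszul_differential scale N R j =
     (if odd j then koszul_d scale R else koszul_d scale R ^^ (N - 1))"

definition koszul_complex_acyclic ::
    "('k::field \<Rightarrow> 'v::ab_group_add \<Rightarrow> 'v) \<Rightarrow> nat \<Rightarrow> ('k, 'v) tensor set \<Rightarrow> bool" where
  "koszul_complex_acyclic scale N R \<longleftrightarrow> (\<forall>j\<ge>1.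
     {x \<in> koszul_chains scale N R j. koszul_differential scale N R j x = \<zero>\<^bsub>koszul_ambient scale R\<^esub>} =
     koszul_differential scale N R (Suc j) ` koszul_chains scale N R (Suc j))"

text \<open>
  A graded algebra is Koszul if it is an \<open>N\<close>-homogeneous algebra \<open>A(E,R)\<close>, up to isomorphism of
  graded algebras, whose Koszul complex is acyclic in positive degrees. For \<open>N \<ge> 2\<close> any two such presentations
  of the same algebra differ by a linear automorphism of \<open>E\<close>, so the choice is immaterial.
\<close>

definition koszul_algebra ::
    "('k::field \<Rightarrow> 'v::ab_group_add \<Rightarrow> 'v) \<Rightarrow> nat \<Rightarrow> ('k, 'a) graded_algebra \<Rightarrow> bool" where
  "koszul_algebra scale N B \<longleftrightarrow> (\<exists>R. linear_subspace R (tensor_algebra scale) \<and>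
     R \<subseteq> tensor_power scale N \<and>
     graded_algebra_isos (homogeneous_algebra scale R) B \<noteq> {} \<and>
     koszul_complex_acyclic scale N R)"

end

(*
  A linear automorphism a of E acts on T(E) degreewise by twist a, the sum of the maps
  x_0 ... x_(n-1) |-> x_0 a(x_1) ... a^(n-1)(x_(n-1)), and twist a identifies A(E, theta_N^-1(R)) with the
  semi-cross product. For f of degree n, the bijection f (x) g |-> twist a f (x) a^n(twist a g) commutes with
  the map d on A (x) T(E), so it identifies the Koszul complexes of A(E, theta_N^-1(R)) and A(E, R) and
  Koszulness passes from A to its semi-cross products. The converse is the same statement for the
  semi-cross product of A^alpha by the inverse of alpha, which is A again.

  All spaces involved are quotients of spaces of finitely supported functions on words or pairs of words,
  so the complex, its differential and the isomorphism can be computed on words.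
*)

theory Submission
  imports Defs
begin

section \<open>Linear algebra of finitely supported functions\<close>

text \<open>Three objects are fixed only by a choice: the homogeneous components of an element, the
  map \<open>koszul_d\<close>, and the presentation inside \<open>koszul_algebra\<close>. The
  components are pinned down because the defining ideal is graded, the map because it respects the
  passage from words to classes and is determined on words. The presentation is left arbitrary and
  Koszulness is carried along any of them; this makes the converse possible, since A^\<alpha> is
  Koszul only through some unnamed presentation. The automorphism is given on the algebra, not on E.
  It comes from a linear automorphism of E because E embeds in A as the degree-one part, and this
  uses N \<ge> 2: in degree one the ideal contains only the linear relations of E. The power of
  \<alpha> in a product depends on the degree of the left factor, so the product formula for the
  twist holds for homogeneous left factors only, and ideals are handled through homogeneous
  generators.\<close>

definition pscale :: "'k::field \<Rightarrow> ('x \<Rightarrow>\<^sub>0 'k) \<Rightarrow> ('x \<Rightarrow>\<^sub>0 'k)" where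
  "pscale c = Poly_Mapping.map ((*) c)"

lemma lookup_pscale [simp]:
  "Poly_Mapping.lookup (pscale c p) k = c * Poly_Mapping.lookup p k"
  by (simp add: pscale_def map.rep_eq when_def)

interpretation pm: vector_space "pscale :: 'k::field \<Rightarrow> ('x \<Rightarrow>\<^sub>0 'k) \<Rightarrow> ('x \<Rightarrow>\<^sub>0 'k)"
  by unfold_locales (auto intro!: poly_mapping_eqI simp: lookup_add algebra_simps)

abbreviation mon :: "'x \<Rightarrow> ('x \<Rightarrow>\<^sub>0 'k::field)" where
  "mon k \<equiv> Poly_Mapping.single k 1"

lemma pscale_single [simp]: "pscale c (Poly_Mapping.single k d) = Poly_Mapping.single k (c * d)"
  by (rule poly_mapping_eqI) (simp add: lookup_single when_def)

lemma single_eq_pscale_mon: "Poly_Mapping.single k c = pscale c (mon k)"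
  by simp

text \<open>The linear extension of a map on basis elements, as an explicit finite sum. The target
  scalar multiplication \<open>s\<close> is a parameter, so that maps into E are covered as
  well.\<close>

definition pext :: "('k::field \<Rightarrow> 'v::ab_group_add \<Rightarrow> 'v) \<Rightarrow> ('x \<Rightarrow> 'v) \<Rightarrow> ('x \<Rightarrow>\<^sub>0 'k) \<Rightarrow> 'v" where
  "pext s f p = (\<Sum>k\<in>Poly_Mapping.keys p. s (Poly_Mapping.lookup p k) (f k))"

context vector_space
begin

lemma pext_superset:
  assumes "finite X" "Poly_Mapping.keys p \<subseteq> X"
  shows "pext scale f p = (\<Sum>k\<in>X. scale (Poly_Mapping.lookup p k) (f k))"
  unfolding pext_def using assms by (intro sum.mono_neutral_left) (auto simp: in_keys_iff)

lemma linear_pext: "Vector_Spaces.linear pscale scale (pext scale f)"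
proof (rule Vector_Spaces.linear_iff[THEN iffD2], intro conjI allI)
  show "vector_space pscale" "vector_space scale" by unfold_locales
  fix x y :: "'c \<Rightarrow>\<^sub>0 'a" and c :: 'a
  let ?X = "Poly_Mapping.keys x \<union> Poly_Mapping.keys y"
  have *: "Poly_Mapping.keys (x + y) \<subseteq> ?X" by (rule Poly_Mapping.keys_add)
  show "pext scale f (x + y) = pext scale f x + pext scale f y"
    by (subst (1 2 3) pext_superset[of ?X])
      (use * in \<open>auto simp: lookup_add scale_left_distrib sum.distrib\<close>)
  have "Poly_Mapping.keys (pscale c x) \<subseteq> Poly_Mapping.keys x"
    by (auto simp: in_keys_iff)
  then show "pext scale f (pscale c x) = scale c (pext scale f x)"
    by (subst (1 2) pext_superset[of "Poly_Mapping.keys x"]) (auto simp: scale_sum_right)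
qed

lemma pext_single [simp]: "pext scale f (Poly_Mapping.single k c) = scale c (f k)"
  by (subst pext_superset[of "{k}"]) auto

end

lemma pext_mon_self [simp]: "pext pscale mon p = p"
  by (rule poly_mapping_eqI) (auto simp: pext_def lookup_sum lookup_single when_def
      if_distrib[of "\<lambda>x. _ * x"] sum.delta in_keys_iff cong: if_cong)

lemma span_mon: "pm.span (range mon) = UNIV"
proof -
  have "p \<in> pm.span (range mon)" for p :: "'x \<Rightarrow>\<^sub>0 'k::field"
  proof -
    have "pext pscale mon p \<in> pm.span (range mon)"
      unfolding pext_def by (intro pm.span_sum pm.span_scale pm.span_base) auto
    then show ?thesis by simp
  qed
  then show ?thesis by blast
qed

text \<open>The basis elements span, so a condition closed under linear combinations needs a check
  on them only.\<close>

lemma subspace_eq_UNIV_I: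
  assumes "pm.subspace U" "\<And>k. mon k \<in> U"
  shows "x \<in> U"
  using pm.span_minimal[of "range mon" U] assms by (auto simp: span_mon)

abbreviation plinear :: "(('x \<Rightarrow>\<^sub>0 'k::field) \<Rightarrow> ('y \<Rightarrow>\<^sub>0 'k)) \<Rightarrow> bool" where
  "plinear \<equiv> Vector_Spaces.linear pscale pscale"

lemma linear_mon_eqI:
  assumes "Vector_Spaces.linear pscale s f" "Vector_Spaces.linear pscale s g"
    and "\<And>k. f (mon k) = g (mon k)"
  shows "f = g"
proof
  fix x
  interpret vector_space_pair pscale s
    using assms(1) by (simp add: Vector_Spaces.linear_iff vector_space_pair_def pm.vector_space_axioms)
  show "f x = g x"
    by (rule linear_eq_on_span[OF assms(1,2), of "range mon"]) (use assms(3) span_mon in auto)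
qed

lemma plinearI:
  assumes "\<And>x y. f (x + y) = f x + f y" "\<And>c x. f (pscale c x) = pscale c (f x)"
  shows "plinear f"
  using assms by (auto simp: Vector_Spaces.linear_iff pm.vector_space_axioms)

lemma plinearD:
  assumes "plinear f"
  shows "f (x + y) = f x + f y" "f (pscale c x) = pscale c (f x)" "f 0 = 0" "f (x - y) = f x - f y"
proof -
  interpret Vector_Spaces.linear pscale pscale f by fact
  show "f (x + y) = f x + f y" "f (pscale c x) = pscale c (f x)" "f 0 = 0" "f (x - y) = f x - f y"
    by (rule add scale zero diff)+
qed

lemma plinear_comp: "plinear f \<Longrightarrow> plinear g \<Longrightarrow> plinear (\<lambda>x. g (f x))"
  by (simp add: plinearI plinearD)

lemma plinear_ident: "plinear (\<lambda>x. x)"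
  by (rule plinearI) auto

lemma span_image_subset:
  assumes "plinear f" "pm.subspace U" "\<And>x. x \<in> X \<Longrightarrow> f x \<in> U" "x \<in> pm.span X"
  shows "f x \<in> U"
proof -
  have "pm.subspace {x. f x \<in> U}"
    using assms(1,2) by (auto simp: pm.subspace_def plinearD)
  then show ?thesis using pm.span_minimal[of X "{x. f x \<in> U}"] assms(3,4) by auto
qed

lemma subspace_vimage: "plinear f \<Longrightarrow> pm.subspace U \<Longrightarrow> pm.subspace {x. f x \<in> U}"
  by (auto simp: pm.subspace_def plinearD)

text \<open>The free vector space functor applied to a map of bases. The twists have this form, so
  their inverse and commutation laws reduce to identities between words.\<close>

definition kmap :: "('x \<Rightarrow> 'y) \<Rightarrow> ('x \<Rightarrow>\<^sub>0 'k::field) \<Rightarrow> ('y \<Rightarrow>\<^sub>0 'k)" where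
  "kmap f = pext pscale (\<lambda>k. mon (f k))"

lemma plinear_kmap: "plinear (kmap f)"
  unfolding kmap_def by (rule pm.linear_pext)

lemma kmap_single [simp]: "kmap f (Poly_Mapping.single k c) = Poly_Mapping.single (f k) c"
  by (simp add: kmap_def)

lemma kmap_kmap: "kmap f (kmap g p) = kmap (\<lambda>k. f (g k)) p"
proof -
  have "(\<lambda>p. kmap f (kmap g p)) = kmap (\<lambda>k. f (g k))"
    by (rule linear_mon_eqI[OF plinear_comp]) (auto intro: plinear_kmap)
  then show ?thesis by (rule fun_cong)
qed

lemma kmap_ident: "kmap (\<lambda>k. k) p = p"
proof -
  have "kmap (\<lambda>k. k) = (\<lambda>p. p)"
    by (rule linear_mon_eqI) (auto intro: plinear_kmap plinear_ident)
  then show ?thesis by (rule fun_cong)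
qed


section \<open>The free algebra\<close>

lemma poly_mapping_additive_induct:
  fixes p :: "'x \<Rightarrow>\<^sub>0 'k::field"
  assumes "P 0" "\<And>x y. P x \<Longrightarrow> P y \<Longrightarrow> P (x + y)" "\<And>k c. P (Poly_Mapping.single k c)"
  shows "P p"
proof -
  have "P (\<Sum>k\<in>A. pscale (Poly_Mapping.lookup p k) (mon k))" if "finite A" for A
    using that by (induction A) (simp_all add: assms)
  then have "P (pext pscale mon p)"
    unfolding pext_def by simp
  then show ?thesis by simp
qed

text \<open>Scalars sit in the algebra as multiples of the empty word and are central; this is why a
  ring ideal is automatically a linear subspace.\<close>

lemma pscale_eq_mult_left: "pscale c p = Poly_Mapping.single [] c * p"
  for p :: "'v list \<Rightarrow>\<^sub>0 'k::field"
  by (induction p rule: poly_mapping_additive_induct)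
    (simp_all add: pm.scale_right_distrib ring_distribs mult_single plus_list_def)

lemma pscale_eq_mult_right: "pscale c p = p * Poly_Mapping.single [] c"
  for p :: "'v list \<Rightarrow>\<^sub>0 'k::field"
  by (induction p rule: poly_mapping_additive_induct)
    (simp_all add: pm.scale_right_distrib ring_distribs mult_single plus_list_def mult_ac)

lemma pscale_mult_left: "pscale c p * q = pscale c (p * q)"
  for p :: "'v list \<Rightarrow>\<^sub>0 'k::field"
  by (simp add: pscale_eq_mult_left mult.assoc)

lemma pscale_mult_right: "p * pscale c q = pscale c (p * q)"
  for p :: "'v list \<Rightarrow>\<^sub>0 'k::field"
  by (simp add: pscale_eq_mult_right mult.assoc)

lemma plinear_mult_left: "plinear (\<lambda>q. p * q)" for p :: "'v list \<Rightarrow>\<^sub>0 'k::field"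
  by (rule plinearI) (simp_all add: pscale_mult_right ring_distribs)

lemma plinear_mult_right: "plinear (\<lambda>p. p * q)" for q :: "'v list \<Rightarrow>\<^sub>0 'k::field"
  by (rule plinearI) (simp_all add: pscale_mult_left ring_distribs)

lemma plinear_sandwich: "plinear (\<lambda>x. u * x * v)" for u v :: "'v list \<Rightarrow>\<^sub>0 'k::field"
  by (rule plinearI) (simp_all add: pscale_mult_left pscale_mult_right ring_distribs)

lemma mon_append: "mon (u @ v) = mon u * mon v" for u v :: "'v list"
  by (simp add: mult_single plus_list_def)

lemma one_eq_mon: "1 = mon []"
  by (simp add: single_one[symmetric] zero_list_def del: single_one)

section \<open>The grading of the free algebra\<close>

definition homog :: "nat \<Rightarrow> ('v list \<Rightarrow>\<^sub>0 'k::field) set" where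
  "homog n = {p. \<forall>w\<in>Poly_Mapping.keys p. length w = n}"

definition pr :: "nat \<Rightarrow> ('v list \<Rightarrow>\<^sub>0 'k::field) \<Rightarrow> ('v list \<Rightarrow>\<^sub>0 'k)" where
  "pr n = pext pscale (\<lambda>w. if length w = n then mon w else 0)"

lemma plinear_pr: "plinear (pr n)"
  unfolding pr_def by (rule pm.linear_pext)

lemma pr_mon: "pr n (mon w) = (if length w = n then mon w else 0)"
  by (simp add: pr_def)

lemma lookup_pr: "Poly_Mapping.lookup (pr n p) w = (if length w = n then Poly_Mapping.lookup p w else 0)"
  by (induction p rule: poly_mapping_additive_induct)
    (auto simp: plinearD[OF plinear_pr] lookup_add pr_def[THEN fun_cong, of n "Poly_Mapping.single _ _"] lookup_single when_def)

lemma homog_iff_lookup: "p \<in> homog n \<longleftrightarrow> (\<forall>w. length w \<noteq> n \<longrightarrow> Poly_Mapping.lookup p w = 0)"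
  by (auto simp: homog_def in_keys_iff)

lemma pr_in_homog [simp]: "pr n p \<in> homog n"
  by (simp add: homog_iff_lookup lookup_pr)

lemma pr_homog: "p \<in> homog n \<Longrightarrow> pr m p = (if m = n then p else 0)"
  by (rule poly_mapping_eqI) (auto simp: homog_iff_lookup lookup_pr)

lemma subspace_homog: "pm.subspace (homog n)"
  by (auto simp: pm.subspace_def homog_iff_lookup lookup_add)

lemma mon_in_homog: "mon w \<in> homog n \<longleftrightarrow> length w = n"
  by (simp add: homog_def)

lemma pr_support: "{n. pr n p \<noteq> 0} \<subseteq> length ` Poly_Mapping.keys p"
proof (rule subsetI, rule ccontr)
  fix n assume "n \<in> {n. pr n p \<noteq> 0}" and n: "n \<notin> length ` Poly_Mapping.keys p"
  moreover have "pr n p = 0"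
    by (rule poly_mapping_eqI) (use n in \<open>auto simp: lookup_pr in_keys_iff\<close>)
  ultimately show False by simp
qed

lemma finite_pr_support: "finite {n. pr n p \<noteq> 0}"
  by (rule finite_subset[OF pr_support]) simp

lemma sum_pr: assumes "finite X" "{n. pr n p \<noteq> 0} \<subseteq> X" shows "(\<Sum>n\<in>X. pr n p) = p"
proof (rule poly_mapping_eqI)
  fix w
  have "length w \<in> X" if "Poly_Mapping.lookup p w \<noteq> 0"
    using that assms(2) by (force simp: poly_mapping_eq_iff fun_eq_iff lookup_pr)
  then show "Poly_Mapping.lookup (\<Sum>n\<in>X. pr n p) w = Poly_Mapping.lookup p w"
    using assms(1) by (auto simp: lookup_sum lookup_pr)
qed

lemma homog_mult: "p \<in> homog m \<Longrightarrow> q \<in> homog n \<Longrightarrow> p * q \<in> homog (m + n)"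
  by (fastforce simp: homog_def plus_list_def dest!: subsetD[OF Poly_Mapping.keys_mult])

lemma homog_eq_span: "homog n = pm.span (mon ` {w. length w = n})"
proof
  show "pm.span (mon ` {w. length w = n}) \<subseteq> homog n"
    by (rule pm.span_minimal) (auto simp: mon_in_homog subspace_homog)
  show "homog n \<subseteq> pm.span (mon ` {w. length w = n})"
  proof
    fix p :: "'v list \<Rightarrow>\<^sub>0 'k::field" assume p: "p \<in> homog n"
    have "pext pscale mon p \<in> pm.span (mon ` {w. length w = n})"
      unfolding pext_def using p by (intro pm.span_sum pm.span_scale pm.span_base) (auto simp: homog_def)
    then show "p \<in> pm.span (mon ` {w. length w = n})" by simp
  qed
qed

text \<open>Degree \<open>n\<close> is spanned by the words of length \<open>n\<close>. The lemma
  serves identities that contain the degree as an exponent and so make sense in a single degree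
  only.\<close>

lemma homog_eqI:
  assumes "plinear f" "plinear g" "\<And>w. length w = n \<Longrightarrow> f (mon w) = g (mon w)" "p \<in> homog n"
  shows "f p = g p"
proof -
  have "pm.subspace {p. f p = g p}"
    using assms(1,2) by (auto simp: pm.subspace_def plinearD)
  then have "homog n \<subseteq> {p. f p = g p}"
    unfolding homog_eq_span by (intro pm.span_minimal) (auto simp: assms(3))
  then show ?thesis using assms(4) by blast
qed

text \<open>The two-sided ideal generated by a set is spanned by the \<open>sandwich\<close> elements.\<close>

definition sandwich :: "('v list \<Rightarrow>\<^sub>0 'k::field) set \<Rightarrow> ('v list \<Rightarrow>\<^sub>0 'k) set" where
  "sandwich X = {mon u * x * mon v | u x v. x \<in> X}"

lemma sandwich_mult_mon:
  assumes "p \<in> pm.span (sandwich X)"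
  shows "mon u * p * mon v \<in> pm.span (sandwich X)"
proof (rule span_image_subset[OF plinear_sandwich _ _ assms])
  fix x assume "x \<in> sandwich X"
  then obtain u' v' y where "x = mon u' * y * mon v'" "y \<in> X"
    by (auto simp: sandwich_def)
  then have "mon u * x * mon v = mon (u @ u') * y * mon (v' @ v)"
    by (simp add: mon_append mult.assoc)
  then show "mon u * x * mon v \<in> pm.span (sandwich X)"
    using \<open>y \<in> X\<close> by (intro pm.span_base) (auto simp: sandwich_def)
qed simp

text \<open>Words are absorbed into the outer words by concatenation; arbitrary factors follow by
  linearity.\<close>

lemma sandwich_ideal:
  assumes "p \<in> pm.span (sandwich X)"
  shows "f * p \<in> pm.span (sandwich X)" "p * f \<in> pm.span (sandwich X)"
proof -
  show "f * p \<in> pm.span (sandwich X)"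
    by (rule subspace_eq_UNIV_I[of "{f. f * p \<in> pm.span (sandwich X)}", simplified])
      (use sandwich_mult_mon[OF assms, of _ "[]"] in
        \<open>auto intro!: subspace_vimage[OF plinear_mult_right] simp: one_eq_mon[symmetric]\<close>)
  show "p * f \<in> pm.span (sandwich X)"
    by (rule subspace_eq_UNIV_I[of "{f. p * f \<in> pm.span (sandwich X)}", simplified])
      (use sandwich_mult_mon[OF assms, of "[]"] in
        \<open>auto intro!: subspace_vimage[OF plinear_mult_left] simp: one_eq_mon[symmetric]\<close>)
qed

lemma sandwich_superset: "X \<subseteq> sandwich X"
  by (auto simp: sandwich_def intro!: exI[of _ "[]"] simp: one_eq_mon[symmetric])

lemma sandwich_mono: "X \<subseteq> Y \<Longrightarrow> sandwich X \<subseteq> sandwich Y"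
  by (auto simp: sandwich_def)


section \<open>The tensor product of free spaces\<close>

text \<open>The canonical bilinear map for free spaces, whose tensor product is the free space on
  pairs of basis elements.\<close>

definition tens :: "('x \<Rightarrow>\<^sub>0 'k::field) \<Rightarrow> ('y \<Rightarrow>\<^sub>0 'k) \<Rightarrow> ('x \<times> 'y \<Rightarrow>\<^sub>0 'k)" where
  "tens p q = pext pscale (\<lambda>u. kmap (Pair u) q) p"

lemma tens_single [simp]:
  "tens (Poly_Mapping.single u c) (Poly_Mapping.single w d) = Poly_Mapping.single (u, w) (c * d)"
  by (simp add: tens_def)

lemma plinear_tens_left: "plinear (\<lambda>p. tens p q)"
  unfolding tens_def by (rule pm.linear_pext)

lemma plinear_tens_right: "plinear (\<lambda>q. tens p q)"
  unfolding tens_def pext_def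
  by (rule plinearI) (simp_all add: plinearD[OF plinear_kmap] pm.scale_right_distrib sum.distrib
      pm.scale_sum_right mult_ac)

lemmas tens_linear = plinearD[OF plinear_tens_left] plinearD[OF plinear_tens_right]

lemma tens_subspaceI:
  assumes "pm.subspace U" "\<And>u. tens (mon u) q \<in> U"
  shows "tens p q \<in> U"
  by (rule subspace_eq_UNIV_I[of "{p. tens p q \<in> U}", simplified])
    (auto intro!: subspace_vimage[OF plinear_tens_left] assms)

lemma tens_subspaceI2:
  assumes "pm.subspace U" "\<And>w. tens p (mon w) \<in> U"
  shows "tens p q \<in> U"
  by (rule subspace_eq_UNIV_I[of "{q. tens p q \<in> U}", simplified])
    (auto intro!: subspace_vimage[OF plinear_tens_right] assms)


section \<open>The Koszul complex of the free algebra modulo an ideal\<close>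

text \<open>Applying \<open>a\<close> to the whole twisted tail adds one power at each step, so the
  letter in position i, counted from 0, receives a^i.\<close>

fun twist_word :: "('v \<Rightarrow> 'v) \<Rightarrow> 'v list \<Rightarrow> 'v list" where
  "twist_word a [] = []"
| "twist_word a (x # w) = x # map a (twist_word a w)"

lemma length_twist_word [simp]: "length (twist_word a w) = length w"
  by (induction w) auto

text \<open>The letters of \<open>v\<close> sit \<open>length u\<close> places further right and
  carry that many extra powers of \<open>a\<close>. This is the origin of the exponent in the
  semi-cross product.\<close>

lemma twist_word_append:
  "twist_word a (u @ v) = twist_word a u @ map (a ^^ length u) (twist_word a v)"
  by (induction u) (auto simp: comp_def)

lemma twist_word_map_commute:
  assumes "\<And>x. a (b x) = b (a x)"
  shows "twist_word a (map b w) = map b (twist_word a w)"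
  by (induction w) (auto simp: assms)

lemma funpow_commute: "(\<And>x. a (b x) = b (a x)) \<Longrightarrow> (a ^^ n) (b x) = b ((a ^^ n) x)"
  by (induction n) auto

lemma twist_word_inverse:
  assumes "\<And>x. b (a x) = x" "\<And>x. a (b x) = x"
  shows "twist_word b (twist_word a w) = w"
  by (induction w) (auto simp: assms twist_word_map_commute comp_def)

text \<open>In the notation of the paper \<open>twist a\<close> is the direct sum of the maps \<open>\<theta>\<^sub>n\<close>, for \<open>a = \<alpha>\<close>.\<close>

definition twist :: "('v \<Rightarrow> 'v) \<Rightarrow> ('v list \<Rightarrow>\<^sub>0 'k::field) \<Rightarrow> ('v list \<Rightarrow>\<^sub>0 'k)" where
  "twist a = kmap (twist_word a)"

definition lmap :: "('v \<Rightarrow> 'v) \<Rightarrow> ('v list \<Rightarrow>\<^sub>0 'k::field) \<Rightarrow> ('v list \<Rightarrow>\<^sub>0 'k)" where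
  "lmap a = kmap (map a)"

lemma plinear_twist: "plinear (twist a)" and plinear_lmap: "plinear (lmap a)"
  unfolding twist_def lmap_def by (rule plinear_kmap)+

lemma twist_single [simp]: "twist a (Poly_Mapping.single w c) = Poly_Mapping.single (twist_word a w) c"
  and lmap_single [simp]: "lmap a (Poly_Mapping.single w c) = Poly_Mapping.single (map a w) c"
  by (simp_all add: twist_def lmap_def)

lemmas twist_linear = plinearD[OF plinear_twist] and lmap_linear = plinearD[OF plinear_lmap]

lemma lmap_mult: "lmap a (p * q) = lmap a p * lmap a q"
proof (induction p rule: poly_mapping_additive_induct)
  case (3 u c)
  show ?case
    by (induction q rule: poly_mapping_additive_induct)
      (simp_all add: lmap_linear mult_single plus_list_def ring_distribs)
qed (simp_all add: lmap_linear ring_distribs)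

lemma lmap_one [simp]: "lmap a 1 = 1"
  by (simp add: one_eq_mon)

lemma lmap_funpow: "(lmap a ^^ n) p = lmap (a ^^ n) p"
proof (induction n)
  case 0
  then show ?case by (simp add: lmap_def id_def kmap_ident)
next
  case (Suc n)
  then show ?case by (simp add: lmap_def kmap_kmap comp_def map_map[unfolded comp_def])
qed

lemma lmap_lmap: "lmap a (lmap b p) = lmap (\<lambda>x. a (b x)) p"
  by (simp add: lmap_def kmap_kmap comp_def)

lemma lmap_ident: "lmap (\<lambda>x. x) p = p"
  by (simp add: lmap_def kmap_ident)

lemma lmap_twist_commute: "lmap a (twist a p) = twist a (lmap a p)"
  by (simp add: lmap_def twist_def kmap_kmap twist_word_map_commute)

lemma twist_twist:
  assumes "\<And>x. b (a x) = x" "\<And>x. a (b x) = x"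
  shows "twist b (twist a p) = p"
  by (simp add: twist_def kmap_kmap twist_word_inverse[OF assms] kmap_ident)

lemma kmap_homog:
  assumes "\<And>w. length (f w) = length w" "p \<in> homog n"
  shows "kmap f p \<in> homog n"
proof (rule span_image_subset[OF plinear_kmap subspace_homog])
  show "p \<in> pm.span (mon ` {w. length w = n})" using assms(2) by (simp add: homog_eq_span)
qed (auto simp: mon_in_homog assms(1))

lemma twist_homog: "p \<in> homog n \<Longrightarrow> twist a p \<in> homog n"
  and lmap_homog: "p \<in> homog n \<Longrightarrow> lmap a p \<in> homog n"
  by (simp_all add: twist_def lmap_def kmap_homog)

lemma pr_kmap:
  assumes "\<And>w. length (f w) = length w"
  shows "pr n (kmap f p) = kmap f (pr n p)"
proof -
  have "(\<lambda>p. pr n (kmap f p)) = (\<lambda>p. kmap f (pr n p))"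
    by (rule linear_mon_eqI) (auto intro!: plinear_comp plinear_pr plinear_kmap
        simp: pr_mon assms plinearD[OF plinear_kmap])
  then show ?thesis by (rule fun_cong)
qed

text \<open>\<open>twist a\<close> carries the product of the free algebra to the semi-cross rule x
  a^n(y); on words this is \<open>twist_word_append\<close>.\<close>

lemma twist_mult_homog:
  assumes "p \<in> homog n"
  shows "twist a (p * q) = twist a p * lmap (a ^^ n) (twist a q)"
proof (rule homog_eqI[OF _ _ _ assms])
  fix w :: "'a list" assume w: "length w = n"
  show "twist a (mon w * q) = twist a (mon w) * lmap (a ^^ n) (twist a q)"
    by (induction q rule: poly_mapping_additive_induct)
      (simp_all add: twist_linear lmap_linear ring_distribs mult_single plus_list_def twist_word_append w)
next
  show "plinear (\<lambda>p. twist a (p * q))"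
    by (rule plinear_comp[OF plinear_mult_right plinear_twist])
  show "plinear (\<lambda>p. twist a p * lmap (a ^^ n) (twist a q))"
    by (rule plinear_comp[OF plinear_twist plinear_mult_right])
qed

text \<open>A pair is a word with a marked cut. Its image is \<open>twist_word a (u @ w)\<close> cut
  at the same place, which is why moving the cut commutes with this map.\<close>

definition shift_word :: "('v \<Rightarrow> 'v) \<Rightarrow> 'v list \<times> 'v list \<Rightarrow> 'v list \<times> 'v list" where
  "shift_word a = (\<lambda>(u, w). (twist_word a u, map (a ^^ length u) (twist_word a w)))"

text \<open>The isomorphism of Koszul complexes: \<open>f \<otimes> g \<mapsto> \<theta>(f) \<otimes> \<alpha>\<^sup>n(\<theta>(g))\<close> for \<open>f\<close> of degree \<open>n\<close>.\<close>

definition koszul_twist ::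
    "('v \<Rightarrow> 'v) \<Rightarrow> ('v list \<times> 'v list \<Rightarrow>\<^sub>0 'k::field) \<Rightarrow> ('v list \<times> 'v list \<Rightarrow>\<^sub>0 'k)" where
  "koszul_twist a = kmap (shift_word a)"

text \<open>The lift of \<open>koszul_d\<close> to pairs of words: the cut moves one letter to the
  right, and a pair with nothing after the cut goes to 0, in line with the convention for
  \<open>koszul_d\<close>.\<close>

definition free_d :: "('v list \<times> 'v list \<Rightarrow>\<^sub>0 'k::field) \<Rightarrow> ('v list \<times> 'v list \<Rightarrow>\<^sub>0 'k)" where
  "free_d = pext pscale (\<lambda>(u, w). case w of [] \<Rightarrow> 0 | e # w' \<Rightarrow> mon (u @ [e], w'))"

lemma plinear_koszul_twist: "plinear (koszul_twist a)"
  unfolding koszul_twist_def by (rule plinear_kmap)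

lemma plinear_free_d: "plinear free_d"
  unfolding free_d_def by (rule pm.linear_pext)

lemma free_d_single [simp]:
  "free_d (Poly_Mapping.single (u, []) c) = 0"
  "free_d (Poly_Mapping.single (u, e # w) c) = Poly_Mapping.single (u @ [e], w) c"
  by (simp_all add: free_d_def)

lemma free_d_koszul_twist: "free_d (koszul_twist a p) = koszul_twist a (free_d p)"
proof -
  have "(\<lambda>p :: 'a list \<times> 'a list \<Rightarrow>\<^sub>0 'b. free_d (koszul_twist a p)) = (\<lambda>p. koszul_twist a (free_d p))"
  proof (rule linear_mon_eqI)
    \<comment> \<open>Behind the moved letter the exponent becomes n + 1 on both sides: the extra
      \<open>a\<close> comes from the twist of the tail or from the longer left word.\<close>
    have comm: "a \<circ> a ^^ n = a ^^ n \<circ> a" for n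
      by (simp add: fun_eq_iff funpow_swap1)
    fix k :: "'a list \<times> 'a list"
    obtain u w where k: "k = (u, w)" by fastforce
    show "free_d (koszul_twist a (mon k)) = koszul_twist a (free_d (mon k) :: 'a list \<times> 'a list \<Rightarrow>\<^sub>0 'b)"
      by (cases w) (auto simp: k koszul_twist_def shift_word_def twist_word_append comm
          plinearD[OF plinear_kmap])
  qed (auto intro!: plinear_comp plinear_koszul_twist plinear_free_d)
  then show ?thesis by (rule fun_cong)
qed

lemma koszul_twist_inverse:
  assumes "\<And>x. b (a x) = x" "\<And>x. a (b x) = x"
  shows "koszul_twist b (koszul_twist a p) = p"
proof -
  have [simp]: "(b ^^ n) ((a ^^ n) x) = x" for n x
    by (induction n arbitrary: x) (auto simp: funpow_swap1 assms)
  have comm: "twist_word b (map (a ^^ n) w) = map (a ^^ n) (twist_word b w)" for n w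
    by (rule twist_word_map_commute) (simp add: funpow_commute assms)
  have "shift_word b (shift_word a k) = k" for k
    by (cases k) (simp add: shift_word_def twist_word_inverse assms comm comp_def)
  then show ?thesis
    by (simp add: koszul_twist_def kmap_kmap kmap_ident)
qed

lemma koszul_twist_tens_homog:
  assumes "p \<in> homog n"
  shows "koszul_twist a (tens p q) = tens (twist a p) (lmap (a ^^ n) (twist a q))"
proof (rule homog_eqI[OF _ _ _ assms])
  fix w :: "'a list" assume w: "length w = n"
  show "koszul_twist a (tens (mon w) q) = tens (twist a (mon w)) (lmap (a ^^ n) (twist a q))"
    by (induction q rule: poly_mapping_additive_induct)
      (simp_all add: tens_linear plinearD[OF plinear_koszul_twist] twist_linear lmap_linear
        koszul_twist_def[THEN fun_cong, of a "Poly_Mapping.single _ _"] shift_word_def w)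
next
  show "plinear (\<lambda>p. koszul_twist a (tens p q))"
    by (rule plinear_comp[OF plinear_tens_left plinear_koszul_twist])
  show "plinear (\<lambda>p. tens (twist a p) (lmap (a ^^ n) (twist a q)))"
    by (rule plinear_comp[OF plinear_twist plinear_tens_left])
qed

lemma koszul_twist_tens_mon:
  "koszul_twist a (tens (mon u) q) = tens (mon (twist_word a u)) (lmap (a ^^ length u) (twist a q))"
  by (simp add: koszul_twist_tens_homog[of "mon u" "length u"] mon_in_homog)

definition free_differential ::
    "nat \<Rightarrow> nat \<Rightarrow> ('v list \<times> 'v list \<Rightarrow>\<^sub>0 'k::field) \<Rightarrow> ('v list \<times> 'v list \<Rightarrow>\<^sub>0 'k)" where
  "free_differential N j = (if odd j then free_d else free_d ^^ (N - 1))"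

lemma free_differential_koszul_twist:
  "free_differential N j (koszul_twist a p) = koszul_twist a (free_differential N j p)"
proof -
  have "(free_d ^^ n) (koszul_twist a p) = koszul_twist a ((free_d ^^ n) p)" for n
    by (induction n) (simp_all add: free_d_koszul_twist)
  then show ?thesis by (simp add: free_differential_def free_d_koszul_twist)
qed

text \<open>The kernel of the map from the free algebra on the set of vectors to T(E).\<close>

abbreviation lin_ideal :: "('a::field \<Rightarrow> 'b::ab_group_add \<Rightarrow> 'b) \<Rightarrow> ('b list \<Rightarrow>\<^sub>0 'a) set" where
  "lin_ideal s \<equiv> pm.span (sandwich (linear_relations s))"

text \<open>
  A subspace \<open>R\<close> of the tensor power of order \<open>N\<close> is represented by the set \<open>S\<close> of homogeneous elements
  of degree \<open>N\<close> of the free algebra whose class is in \<open>R\<close>.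
\<close>

definition relation_ideal :: "('a::field \<Rightarrow> 'b::ab_group_add \<Rightarrow> 'b) \<Rightarrow> ('b list \<Rightarrow>\<^sub>0 'a) set \<Rightarrow> ('b list \<Rightarrow>\<^sub>0 'a) set" where
  "relation_ideal s S = pm.span (sandwich (S \<union> (linear_relations s)))"

text \<open>The full preimage of \<open>koszul_dual_space\<close> in the free algebra. Each span
  includes the kernel, which lets the intersection be formed before passing to classes.\<close>

definition free_dual :: "('a::field \<Rightarrow> 'b::ab_group_add \<Rightarrow> 'b) \<Rightarrow> nat \<Rightarrow> ('b list \<Rightarrow>\<^sub>0 'a) set \<Rightarrow> nat \<Rightarrow> ('b list \<Rightarrow>\<^sub>0 'a) set" where
  "free_dual s N S i =
     (if i < N then pm.span (homog i \<union> lin_ideal s)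
      else (\<Inter>(r, t) \<in> {(r, t). r + t = i - N}.
        pm.span ({mon u * x * mon v | u x v. length u = r \<and> x \<in> S \<and> length v = t} \<union> lin_ideal s)))"

text \<open>The kernel of the map from pairs of words to A \<otimes> T(E): by right exactness, the
  relations in either factor.\<close>

definition koszul_kernel :: "('a::field \<Rightarrow> 'b::ab_group_add \<Rightarrow> 'b) \<Rightarrow> ('b list \<Rightarrow>\<^sub>0 'a) set \<Rightarrow> ('b list \<times> 'b list \<Rightarrow>\<^sub>0 'a) set" where
  "koszul_kernel s S = pm.span ({tens f i | f i. i \<in> lin_ideal s} \<union> {tens i g | i g. i \<in> relation_ideal s S})"

definition free_chains ::
    "('a::field \<Rightarrow> 'b::ab_group_add \<Rightarrow> 'b) \<Rightarrow> nat \<Rightarrow> ('b list \<Rightarrow>\<^sub>0 'a) set \<Rightarrow> nat \<Rightarrow> ('b list \<times> 'b list \<Rightarrow>\<^sub>0 'a) set" where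
  "free_chains s N S j =
     pm.span ({tens f w | f w. w \<in> free_dual s N S (koszul_degree N j)} \<union> koszul_kernel s S)"

text \<open>Exactness on representatives, with every equation read modulo
  \<open>koszul_kernel\<close>. The equivalence covers both inclusions between cycles and
  boundaries.\<close>

definition free_acyclic :: "('a::field \<Rightarrow> 'b::ab_group_add \<Rightarrow> 'b) \<Rightarrow> nat \<Rightarrow> ('b list \<Rightarrow>\<^sub>0 'a) set \<Rightarrow> bool" where
  "free_acyclic s N S \<longleftrightarrow> (\<forall>j\<ge>1. \<forall>x. x \<in> free_chains s N S j \<and> free_differential N j x \<in> koszul_kernel s S \<longleftrightarrow>
     (\<exists>y\<in>free_chains s N S (Suc j). x - free_differential N (Suc j) y \<in> koszul_kernel s S))"

section \<open>Stability of the ideals, the Koszul spaces and the chains under the twist\<close>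

context vector_space
begin

lemma linear_funpow:
  assumes "Vector_Spaces.linear scale scale c"
  shows "Vector_Spaces.linear scale scale (c ^^ n)"
proof (induction n)
  case (Suc n)
  interpret c: Vector_Spaces.linear scale scale c by fact
  interpret cn: Vector_Spaces.linear scale scale "c ^^ n" by fact
  show ?case
    by (auto simp: Vector_Spaces.linear_iff vector_space_axioms c.add c.scale cn.add cn.scale)
qed (simp add: id_def linear_ident)

lemma lmap_lin_rel:
  assumes "Vector_Spaces.linear scale scale c" "r \<in> linear_relations scale"
  shows "lmap c r \<in> linear_relations scale"
proof -
  interpret c: Vector_Spaces.linear scale scale c by fact
  from assms(2) consider (add) x y where "r = mon [x + y] - mon [x] - mon [y]"
    | (scale) d x where "r = mon [scale d x] - Poly_Mapping.single [x] d"
    unfolding linear_relations_def by blast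
  then show ?thesis
  proof cases
    case add
    then have "lmap c r = mon [c x + c y] - mon [c x] - mon [c y]"
      by (simp add: lmap_linear c.add)
    then show ?thesis unfolding linear_relations_def by blast
  next
    case scale
    then have "lmap c r = mon [scale d (c x)] - Poly_Mapping.single [c x] d"
      by (simp add: lmap_linear c.scale)
    then show ?thesis unfolding linear_relations_def by blast
  qed
qed

lemma lin_rel_homog: "r \<in> (linear_relations scale) \<Longrightarrow> r \<in> homog 1"
  unfolding linear_relations_def
  by (auto intro!: pm.subspace_diff[OF subspace_homog]) (auto simp: homog_iff_lookup lookup_single when_def)

text \<open>Linear relations have degree one, and the letter in position 0 receives no power of
  \<open>c\<close>.\<close>

lemma twist_lin_rel: "r \<in> (linear_relations scale) \<Longrightarrow> twist c r = r"
  unfolding linear_relations_def by (auto simp: twist_linear)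

lemma lmap_sandwich:
  assumes "\<And>x. x \<in> X \<Longrightarrow> lmap c x \<in> Y" "p \<in> pm.span (sandwich X)"
  shows "lmap c p \<in> pm.span (sandwich Y)"
  by (rule span_image_subset[OF plinear_lmap _ _ assms(2)])
    (auto intro!: pm.span_base simp: sandwich_def lmap_mult assms(1), metis assms(1))

lemma lmap_lin_ideal:
  assumes "Vector_Spaces.linear scale scale c" "p \<in> lin_ideal scale"
  shows "lmap c p \<in> lin_ideal scale"
  using lmap_sandwich[OF lmap_lin_rel[OF assms(1)] assms(2)] by simp

lemma twist_sandwich_homog:
  assumes "x \<in> homog n"
  shows "twist a (mon u * x * mon v) =
    mon (twist_word a u) * lmap (a ^^ length u) (twist a x) * mon (map (a ^^ (length u + n)) (twist_word a v))"
proof -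
  have "mon u * x \<in> homog (length u + n)"
    by (rule homog_mult) (auto simp: mon_in_homog assms)
  then show ?thesis
    by (simp add: twist_mult_homog twist_mult_homog[of "mon u" "length u"] mon_in_homog)
qed

text \<open>A generator inside a sandwich lands on its twist moved by c^k, with k the length of the
  word in front. Every k occurs, hence the hypothesis on all powers.\<close>

lemma twist_sandwich:
  assumes "Vector_Spaces.linear scale scale c"
    and "\<And>x. x \<in> X \<Longrightarrow> \<exists>n. x \<in> homog n" "\<And>x n. x \<in> X \<Longrightarrow> lmap (c ^^ n) (twist c x) \<in> Y"
    and "p \<in> pm.span (sandwich X)"
  shows "twist c p \<in> pm.span (sandwich Y)"
proof (rule span_image_subset[OF plinear_twist _ _ assms(4)])
  fix x assume "x \<in> sandwich X"
  then obtain u y v where x: "x = mon u * y * mon v" "y \<in> X"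
    by (auto simp: sandwich_def)
  obtain n where n: "y \<in> homog n" using assms(2) x(2) by blast
  show "twist c x \<in> pm.span (sandwich Y)"
    unfolding x(1) twist_sandwich_homog[OF n] using assms(3)[OF x(2), of "length u"]
    by (intro pm.span_base) (auto simp: sandwich_def)
qed simp

lemma twist_lin_ideal:
  assumes "Vector_Spaces.linear scale scale c" "p \<in> lin_ideal scale"
  shows "twist c p \<in> lin_ideal scale"
  by (rule twist_sandwich[OF assms(1) _ _ assms(2)])
    (use lin_rel_homog in \<open>auto simp: twist_lin_rel lmap_lin_rel[OF linear_funpow[OF assms(1)]]\<close>)

end

text \<open>One direction of the transfer, with \<open>c\<close> the automorphism of E or its
  inverse. Only inclusions are proved here; two instances with \<open>S\<close> and
  \<open>S'\<close> exchanged give equalities.\<close>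

locale koszul_transfer = vector_space scale
  for scale :: "'a::field \<Rightarrow> 'b::ab_group_add \<Rightarrow> 'b" +
  fixes N :: nat and S S' :: "('b list \<Rightarrow>\<^sub>0 'a) set" and c :: "'b \<Rightarrow> 'b"
  assumes linear_c: "Vector_Spaces.linear scale scale c"
    and homog: "S \<subseteq> homog N"
    and twist_S: "\<And>x. x \<in> S \<Longrightarrow> twist c x \<in> S'"
    and lmap_S': "\<And>x. x \<in> S' \<Longrightarrow> lmap c x \<in> S'"
begin

lemma linear_cn: "Vector_Spaces.linear scale scale (c ^^ n)"
  by (rule linear_funpow[OF linear_c])

lemma lmap_funpow_S': "x \<in> S' \<Longrightarrow> lmap (c ^^ n) x \<in> S'"
proof (induction n)
  case (Suc n)
  have "lmap c (lmap (c ^^ n) x) \<in> S'" by (rule lmap_S'[OF Suc.IH[OF Suc.prems]])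
  then show ?case by (simp add: lmap_lmap comp_def)
qed (simp add: id_def lmap_ident)

lemma twist_relation_ideal:
  assumes "p \<in> relation_ideal scale S"
  shows "twist c p \<in> relation_ideal scale S'"
  using assms unfolding relation_ideal_def
  by (rule twist_sandwich[OF linear_c, rotated 2])
    (use lin_rel_homog homog in \<open>auto simp: twist_lin_rel lmap_lin_rel[OF linear_cn]
      intro!: lmap_funpow_S' twist_S\<close>)

text \<open>The power c^n appears because \<open>koszul_twist\<close> applies it to the second
  factor, with n the length of the first. Sandwiches keep their outer lengths, so each member of the
  intersection is respected separately.\<close>

lemma twist_free_dual:
  assumes "p \<in> free_dual scale N S i"
  shows "lmap (c ^^ n) (twist c p) \<in> free_dual scale N S' i"
proof -
  have lin: "plinear (\<lambda>p. lmap (c ^^ n) (twist c p))"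
    by (rule plinear_comp[OF plinear_twist plinear_lmap])
  have ideal: "lmap (c ^^ n) (twist c p) \<in> lin_ideal scale" if "p \<in> lin_ideal scale" for p
    by (rule lmap_lin_ideal[OF linear_cn twist_lin_ideal[OF linear_c that]])
  show ?thesis
  proof (cases "i < N")
    case True
    then have p: "p \<in> pm.span (homog i \<union> lin_ideal scale)"
      using assms by (simp add: free_dual_def)
    have "lmap (c ^^ n) (twist c p) \<in> pm.span (homog i \<union> lin_ideal scale)"
    proof (rule span_image_subset[OF lin _ _ p])
      fix x assume "x \<in> homog i \<union> lin_ideal scale"
      then have "lmap (c ^^ n) (twist c x) \<in> homog i \<union> lin_ideal scale"
        using ideal lmap_homog twist_homog by blast
      then show "lmap (c ^^ n) (twist c x) \<in> pm.span (homog i \<union> lin_ideal scale)"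
        by (rule pm.span_base)
    qed simp
    then show ?thesis using True by (simp add: free_dual_def)
  next
    case False
    let ?gen = "\<lambda>r s S. {mon u * x * mon v | u x v. length u = r \<and> x \<in> S \<and> length v = s}"
    have "lmap (c ^^ n) (twist c p) \<in> pm.span (?gen r s S' \<union> lin_ideal scale)" if rs: "r + s = i - N" for r s
    proof -
      have p: "p \<in> pm.span (?gen r s S \<union> lin_ideal scale)"
        using assms False rs by (auto simp: free_dual_def)
      show ?thesis
      proof (rule span_image_subset[OF lin _ _ p])
        fix x assume "x \<in> ?gen r s S \<union> lin_ideal scale"
        then show "lmap (c ^^ n) (twist c x) \<in> pm.span (?gen r s S' \<union> lin_ideal scale)"
        proof
          assume "x \<in> ?gen r s S"
          then obtain u y v where x: "x = mon u * y * mon v" "length u = r" "y \<in> S" "length v = s"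
            by blast
          have y: "y \<in> homog N" using x(3) homog by blast
          have "lmap (c ^^ n) (lmap (c ^^ length u) (twist c y)) \<in> S'"
            by (intro lmap_funpow_S' twist_S x(3))
          moreover have "lmap (c ^^ n) (twist c x) = mon (map (c ^^ n) (twist_word c u)) *
              lmap (c ^^ n) (lmap (c ^^ length u) (twist c y)) *
              mon (map (c ^^ n) (map (c ^^ (length u + N)) (twist_word c v)))"
            unfolding x(1) twist_sandwich_homog[OF y] lmap_mult lmap_single ..
          moreover have "length (map (c ^^ n) (twist_word c u)) = r"
            "length (map (c ^^ n) (map (c ^^ (length u + N)) (twist_word c v))) = s"
            using x(2,4) by simp_all
          ultimately have "lmap (c ^^ n) (twist c x) \<in> ?gen r s S'"
            by blast
          then show ?thesis
            by (intro pm.span_base UnI1)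
        next
          assume "x \<in> lin_ideal scale"
          then show ?thesis by (rule pm.span_base[OF UnI2[OF ideal]])
        qed
      qed simp
    qed
    then show ?thesis using False by (auto simp: free_dual_def)
  qed
qed

lemma koszul_twist_koszul_kernel:
  assumes "x \<in> koszul_kernel scale S"
  shows "koszul_twist c x \<in> koszul_kernel scale S'"
proof (rule span_image_subset[OF plinear_koszul_twist])
  show "pm.subspace (koszul_kernel scale S')" by (simp add: koszul_kernel_def)
  show "x \<in> pm.span ({tens f i | f i. i \<in> lin_ideal scale} \<union> {tens i g | i g. i \<in> relation_ideal scale S})"
    using assms by (simp add: koszul_kernel_def)
  have right: "tens f i \<in> koszul_kernel scale S'" if "i \<in> lin_ideal scale" for f i
    unfolding koszul_kernel_def using that by (intro pm.span_base) blast
  have left: "tens i g \<in> koszul_kernel scale S'" if "i \<in> relation_ideal scale S'" for g i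
    unfolding koszul_kernel_def using that by (intro pm.span_base) blast
  have sub: "pm.subspace {x. koszul_twist c x \<in> koszul_kernel scale S'}"
    by (rule subspace_vimage[OF plinear_koszul_twist]) (simp add: koszul_kernel_def)
  fix x assume "x \<in> {tens f i | f i. i \<in> lin_ideal scale} \<union> {tens i g | i g. i \<in> relation_ideal scale S}"
  then show "koszul_twist c x \<in> koszul_kernel scale S'"
  proof
    assume "x \<in> {tens f i | f i. i \<in> lin_ideal scale}"
    then obtain f i where x: "x = tens f i" "i \<in> lin_ideal scale" by blast
    have "koszul_twist c (tens (mon u) i) \<in> koszul_kernel scale S'" for u
      unfolding koszul_twist_tens_mon
      \<comment> \<open>The left factor is a single word here, as the power of \<open>c\<close> on
        the right depends on its length.\<close>
      by (intro right lmap_lin_ideal[OF linear_cn] twist_lin_ideal[OF linear_c] x(2))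
    then show ?thesis
      unfolding x(1) using tens_subspaceI[where q = i and p = f, OF sub] by blast
  next
    assume "x \<in> {tens i g | i g. i \<in> relation_ideal scale S}"
    then obtain i g where x: "x = tens i g" "i \<in> relation_ideal scale S" by blast
    have lin: "plinear (\<lambda>i. koszul_twist c (tens i g))"
      by (rule plinear_comp[OF plinear_tens_left plinear_koszul_twist])
    show ?thesis unfolding x(1)
    proof (rule span_image_subset[OF lin])
      show "i \<in> pm.span (sandwich (S \<union> linear_relations scale))" using x(2) by (simp add: relation_ideal_def)
      fix y assume y: "y \<in> sandwich (S \<union> linear_relations scale)"
      then obtain u z v where z: "y = mon u * z * mon v" "z \<in> S \<union> linear_relations scale"
        by (auto simp: sandwich_def)
      \<comment> \<open>Sandwiches of homogeneous generators are homogeneous, so one exponent serves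
        the whole left factor.\<close>
      obtain m where "z \<in> homog m" using z(2) homog lin_rel_homog by blast
      then have "y \<in> homog (length u + m + length v)"
        unfolding z(1) by (intro homog_mult) (auto simp: mon_in_homog)
      moreover have "y \<in> relation_ideal scale S"
        unfolding relation_ideal_def using y by (rule pm.span_base)
      ultimately show "koszul_twist c (tens y g) \<in> koszul_kernel scale S'"
        by (subst koszul_twist_tens_homog) (assumption, intro left twist_relation_ideal)
    qed (simp add: koszul_kernel_def)
  qed
qed

lemma koszul_twist_free_chains:
  assumes "x \<in> free_chains scale N S j"
  shows "koszul_twist c x \<in> free_chains scale N S' j"
proof (rule span_image_subset[OF plinear_koszul_twist])
  let ?W = "\<lambda>S. {tens f w | f w. w \<in> free_dual scale N S (koszul_degree N j)}"
  show sub: "pm.subspace (free_chains scale N S' j)" by (simp add: free_chains_def)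
  show "x \<in> pm.span (?W S \<union> koszul_kernel scale S)" using assms by (simp add: free_chains_def)
  have gen: "tens f w \<in> free_chains scale N S' j" if "w \<in> free_dual scale N S' (koszul_degree N j)" for f w
    unfolding free_chains_def using that by (intro pm.span_base) blast
  fix x assume "x \<in> ?W S \<union> koszul_kernel scale S"
  then show "koszul_twist c x \<in> free_chains scale N S' j"
  proof
    assume "x \<in> ?W S"
    then obtain f w where x: "x = tens f w" "w \<in> free_dual scale N S (koszul_degree N j)" by blast
    have "koszul_twist c (tens (mon u) w) \<in> free_chains scale N S' j" for u
      unfolding koszul_twist_tens_mon by (intro gen twist_free_dual x(2))
    then show ?thesis
      unfolding x(1) using tens_subspaceI[where q = w and p = f, OF subspace_vimage[OF plinear_koszul_twist sub]] by blast
  next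
    assume "x \<in> koszul_kernel scale S"
    then have "koszul_twist c x \<in> koszul_kernel scale S'" by (rule koszul_twist_koszul_kernel)
    then show ?thesis unfolding free_chains_def by (intro pm.span_base) blast
  qed
qed

end

text \<open>The inclusions along \<open>a\<close> and along \<open>b\<close> show that
  \<open>koszul_twist a\<close> preserves and reflects chains and kernel, so the exactness condition
  passes through it unchanged.\<close>

lemma (in vector_space) free_acyclic_transfer:
  assumes "koszul_transfer scale N S S' a" "koszul_transfer scale N S' S b"
    and inv: "\<And>x. b (a x) = x" "\<And>x. a (b x) = x"
    and "free_acyclic scale N S'"
  shows "free_acyclic scale N S"
proof -
  interpret A: koszul_transfer scale N S S' a by fact
  interpret B: koszul_transfer scale N S' S b by fact
  note ba = koszul_twist_inverse[OF inv] and ab = koszul_twist_inverse[OF inv(2,1)]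
  have chains: "koszul_twist a x \<in> free_chains scale N S' j \<longleftrightarrow> x \<in> free_chains scale N S j" for x j
    using A.koszul_twist_free_chains B.koszul_twist_free_chains by (metis ba)
  have kernel: "koszul_twist a x \<in> koszul_kernel scale S' \<longleftrightarrow> x \<in> koszul_kernel scale S" for x
    using A.koszul_twist_koszul_kernel B.koszul_twist_koszul_kernel by (metis ba)
  show ?thesis
    unfolding free_acyclic_def
  proof (intro allI impI)
    fix j :: nat and x assume j: "j \<ge> 1"
    have "x \<in> free_chains scale N S j \<and> free_differential N j x \<in> koszul_kernel scale S \<longleftrightarrow>
      koszul_twist a x \<in> free_chains scale N S' j \<and> free_differential N j (koszul_twist a x) \<in> koszul_kernel scale S'"
      by (simp add: chains kernel free_differential_koszul_twist)
    also have "\<dots> \<longleftrightarrow> (\<exists>y\<in>free_chains scale N S' (Suc j).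
        koszul_twist a x - free_differential N (Suc j) y \<in> koszul_kernel scale S')"
      using assms(5) j unfolding free_acyclic_def by blast
    \<comment> \<open>Every chain \<open>y\<close> for \<open>S'\<close> is the image of the chain
      \<open>koszul_twist b y\<close> for \<open>S\<close>.\<close>
    also have "\<dots> \<longleftrightarrow> (\<exists>y\<in>free_chains scale N S (Suc j).
        koszul_twist a x - free_differential N (Suc j) (koszul_twist a y) \<in> koszul_kernel scale S')"
      by (metis chains ab)
    also have "\<dots> \<longleftrightarrow> (\<exists>y\<in>free_chains scale N S (Suc j). x - free_differential N (Suc j) y \<in> koszul_kernel scale S)"
      by (simp add: free_differential_koszul_twist kernel plinearD(4)[OF plinear_koszul_twist, symmetric])
    finally show "x \<in> free_chains scale N S j \<and> free_differential N j x \<in> koszul_kernel scale S \<longleftrightarrow>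
      (\<exists>y\<in>free_chains scale N S (Suc j). x - free_differential N (Suc j) y \<in> koszul_kernel scale S)" .
  qed
qed


section \<open>Presentations of vector spaces and algebras\<close>

text \<open>A vector space with carrier as a quotient of a free space by \<open>K\<close>. Equality
  of classes becomes membership in \<open>K\<close>, so nested cosets need not be opened in
  computations.\<close>

locale presentation =
  fixes V :: "('k::field, 'a, 'm) module_scheme" and q :: "('x \<Rightarrow>\<^sub>0 'k) \<Rightarrow> 'a" and K
  assumes carrier_eq: "carrier V = range q"
    and q_add: "q (x + y) = q x \<oplus>\<^bsub>V\<^esub> q y"
    and q_scale: "q (pscale c x) = c \<odot>\<^bsub>V\<^esub> q x"
    and q_zero: "q 0 = \<zero>\<^bsub>V\<^esub>"
    and q_eq_iff: "q x = q y \<longleftrightarrow> x - y \<in> K"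
begin

lemma q_eq_zero_iff: "q x = \<zero>\<^bsub>V\<^esub> \<longleftrightarrow> x \<in> K"
  using q_eq_iff[of x 0] by (simp add: q_zero)

lemma subspace_kernel: "pm.subspace K"
  unfolding pm.subspace_def
proof (intro conjI ballI allI)
  show "0 \<in> K" using q_eq_iff[of 0 0] by simp
  fix x y c assume x: "x \<in> K"
  then have "q x = q 0" using q_eq_iff[of x 0] by simp
  then show "pscale c x \<in> K"
    using q_eq_iff[of "pscale c x" 0] q_scale[of c x] q_scale[of c 0] by simp
  assume "y \<in> K"
  then have "q y = q 0" using q_eq_iff[of y 0] by simp
  with \<open>q x = q 0\<close> show "x + y \<in> K"
    using q_eq_iff[of "x + y" 0] q_add[of x y] q_add[of 0 0] by simp
qed

lemma q_in_carrier [simp]: "q x \<in> carrier V"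
  by (simp add: carrier_eq)

lemma abelian_group: "abelian_group V"
proof (rule abelian_groupI)
  show "\<exists>y\<in>carrier V. y \<oplus>\<^bsub>V\<^esub> x = \<zero>\<^bsub>V\<^esub>" if x: "x \<in> carrier V" for x
  proof -
    obtain p where "x = q p" using x by (auto simp: carrier_eq)
    then have "q (- p) \<oplus>\<^bsub>V\<^esub> x = \<zero>\<^bsub>V\<^esub>"
      by (simp add: q_add[symmetric] q_zero)
    then show ?thesis by (rule bexI) simp
  qed
qed (auto simp: carrier_eq q_add[symmetric] q_zero[symmetric] add_ac)

lemma a_inv_q: "\<ominus>\<^bsub>V\<^esub> q x = q (- x)"
  by (rule abelian_group.minus_equality[OF abelian_group]) (simp_all add: q_add[symmetric] q_zero)

lemma module_scalars: "Module.module scalars V"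
proof (rule moduleI)
  have "\<exists>y. x + y = 0" for x :: 'k by (rule exI[of _ "- x"]) simp
  then show "cring (scalars :: 'k ring)"
    by unfold_locales (auto simp: scalars_def algebra_simps Units_def)
qed (auto simp: abelian_group scalars_def carrier_eq q_add[symmetric] q_scale[symmetric]
    pm.scale_right_distrib pm.scale_left_distrib)

lemma subspace_vimage_submodule:
  assumes "linear_subspace U V"
  shows "pm.subspace {x. q x \<in> U}" "K \<subseteq> {x. q x \<in> U}" "U = q ` {x. q x \<in> U}"
proof -
  interpret Module.module scalars V by (rule module_scalars)
  note E = submoduleE[OF assms]
  have zero: "\<zero>\<^bsub>V\<^esub> \<in> U"
    using E(2,3,5) E(1) by (metis M.r_neg ex_in_conv subsetD)
  show "pm.subspace {x. q x \<in> U}"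
    using zero E(4,5) by (auto simp: pm.subspace_def q_zero q_add q_scale scalars_def)
  show "K \<subseteq> {x. q x \<in> U}" using zero by (auto simp: q_eq_zero_iff[symmetric])
  show "U = q ` {x. q x \<in> U}" using E(1) by (auto simp: carrier_eq)
qed

lemma submodule_image:
  assumes "pm.subspace X"
  shows "linear_subspace (q ` X) V"
proof -
  interpret Module.module scalars V by (rule module_scalars)
  show ?thesis
  proof (rule submoduleI)
    show "\<zero>\<^bsub>V\<^esub> \<in> q ` X"
      using pm.subspace_0[OF assms] q_zero by force
  qed (use assms in \<open>auto simp: a_inv_q q_add[symmetric] q_scale[symmetric]
      intro!: imageI pm.subspace_neg pm.subspace_add pm.subspace_scale\<close>)
qed

lemma span_in_image: "span_in V (q ` X) = q ` pm.span X"
proof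
  show "span_in V (q ` X) \<subseteq> q ` pm.span X"
    unfolding span_in_def
    by (rule Inter_lower) (auto simp: submodule_image intro: pm.span_base)
  have "q ` pm.span X \<subseteq> U" if "linear_subspace U V" "q ` X \<subseteq> U" for U
    using pm.span_minimal[OF _ subspace_vimage_submodule(1)[OF that(1)], of X] that(2) by auto
  then show "q ` pm.span X \<subseteq> span_in V (q ` X)"
    unfolding span_in_def by blast
qed

text \<open>A subspace that contains the kernel is a union of cosets, so membership can be read off
  on any representative.\<close>

lemma image_mem_iff:
  assumes "pm.subspace X" "K \<subseteq> X"
  shows "q x \<in> q ` X \<longleftrightarrow> x \<in> X"
proof
  assume "q x \<in> q ` X"
  then obtain y where "y \<in> X" "x - y \<in> X" using q_eq_iff assms(2) by blast
  then show "x \<in> X" using pm.subspace_add[OF assms(1), of "x - y" y] by simp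
qed simp

text \<open>Kernel elements have class 0. This allows a spanning set to be completed to a full
  preimage, where \<open>image_mem_iff\<close> applies.\<close>

lemma image_span_kernel: "q ` pm.span (X \<union> K) = q ` pm.span X"
proof
  show "q ` pm.span (X \<union> K) \<subseteq> q ` pm.span X"
  proof
    fix z assume "z \<in> q ` pm.span (X \<union> K)"
    then obtain x y where z: "z = q (x + y)" "x \<in> pm.span X" "y \<in> pm.span K"
      unfolding pm.span_Un by auto
    then have "z = q x"
      using q_eq_iff[of "x + y" x] subspace_kernel by (simp add: pm.span_eq_iff[THEN iffD2])
    then show "z \<in> q ` pm.span X" using z(2) by blast
  qed
  show "q ` pm.span X \<subseteq> q ` pm.span (X \<union> K)"
    by (intro image_mono pm.span_mono) blast
qed

lemma finsum_q:
  assumes "finite X"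
  shows "(\<Oplus>\<^bsub>V\<^esub>n\<in>X. q (f n)) = q (\<Sum>n\<in>X. f n)"
proof -
  interpret abelian_group V by (rule abelian_group)
  show ?thesis
    using assms by (induction X) (simp_all add: q_zero q_add Pi_def)
qed

lemma coset_eq: "q ` X +>\<^bsub>V\<^esub> q x = (\<lambda>k. q (k + x)) ` X"
  by (auto simp: a_r_coset_def' q_add)

text \<open>A quotient of a quotient is a quotient of the free space by the larger kernel
  \<open>X\<close>. In its algebra form, applied twice, this presents A(E,R) directly on
  words.\<close>

lemma presentation_quotient:
  assumes X: "pm.subspace X" "K \<subseteq> X"
  shows "presentation (quotient_module V (q ` X)) (\<lambda>x. q ` X +>\<^bsub>V\<^esub> q x) X"
proof
  let ?Q = "quotient_module V (q ` X)" and ?c = "\<lambda>x. (\<lambda>k. q (k + x)) ` X"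
  have quot: "carrier ?Q = a_rcosets\<^bsub>V\<^esub> (q ` X)" "\<zero>\<^bsub>?Q\<^esub> = q ` X" "add ?Q = set_add V"
    "smult ?Q = (\<lambda>c Y. \<Union>x\<in>Y. q ` X +>\<^bsub>V\<^esub> (c \<odot>\<^bsub>V\<^esub> x))"
    by (simp_all add: quotient_module_def ring.defs module.defs FactRing_def)
  show "carrier ?Q = range (\<lambda>x. q ` X +>\<^bsub>V\<^esub> q x)"
    by (auto simp: quot A_RCOSETS_def' carrier_eq)
  fix x y and c
  show eq: "q ` X +>\<^bsub>V\<^esub> q x = q ` X +>\<^bsub>V\<^esub> q y \<longleftrightarrow> x - y \<in> X" for x y
    unfolding coset_eq
  proof
    assume *: "?c x = ?c y"
    have "q x \<in> ?c x" using pm.subspace_0[OF X(1)] by force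
    then obtain k where "k \<in> X" "x - (k + y) \<in> X" using q_eq_iff X(2) * by auto
    then show "x - y \<in> X" using pm.subspace_add[OF X(1), of "x - (k + y)" k] by simp
  next
    assume *: "x - y \<in> X"
    have "q (k + x) \<in> ?c y" if "k \<in> X" for k
      using pm.subspace_add[OF X(1) that *] by (intro image_eqI[of _ _ "k + (x - y)"]) simp_all
    moreover have "q (k + y) \<in> ?c x" if "k \<in> X" for k
      using pm.subspace_diff[OF X(1) that *] by (intro image_eqI[of _ _ "k - (x - y)"]) simp_all
    ultimately show "?c x = ?c y" by blast
  qed
  show "q ` X +>\<^bsub>V\<^esub> q (x + y) = (q ` X +>\<^bsub>V\<^esub> q x) \<oplus>\<^bsub>?Q\<^esub> (q ` X +>\<^bsub>V\<^esub> q y)"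
    unfolding quot coset_eq set_add_def'
  proof safe
    fix k assume "k \<in> X"
    then have "q (k + x) \<in> ?c x" "q (0 + y) \<in> ?c y"
      using pm.subspace_0[OF X(1)] by blast+
    moreover have "q (k + (x + y)) = q (k + x) \<oplus>\<^bsub>V\<^esub> q (0 + y)"
      by (simp add: q_add[symmetric] add_ac)
    ultimately show "q (k + (x + y)) \<in> (\<Union>h\<in>?c x. \<Union>k\<in>?c y. {h \<oplus>\<^bsub>V\<^esub> k})"
      by blast
  next
    fix k l assume "k \<in> X" "l \<in> X"
    then show "q (k + x) \<oplus>\<^bsub>V\<^esub> q (l + y) \<in> ?c (x + y)"
      using pm.subspace_add[OF X(1), of k l]
      by (intro image_eqI[of _ _ "k + l"]) (simp_all add: q_add[symmetric] add_ac)
  qed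
  show "q ` X +>\<^bsub>V\<^esub> q 0 = \<zero>\<^bsub>?Q\<^esub>"
    by (simp add: quot coset_eq)
  \<comment> \<open>Scalar multiplication of cosets is a union over representatives; all of them
    yield the same coset.\<close>
  have "q ` X +>\<^bsub>V\<^esub> q (pscale c (k + x)) = q ` X +>\<^bsub>V\<^esub> q (pscale c x)" if "k \<in> X" for k
    using eq pm.subspace_scale[OF X(1) that] by (simp add: pm.scale_right_distrib)
  then show "q ` X +>\<^bsub>V\<^esub> q (pscale c x) = c \<odot>\<^bsub>?Q\<^esub> (q ` X +>\<^bsub>V\<^esub> q x)"
    unfolding quot using pm.subspace_0[OF X(1)]
    by (auto simp: coset_eq[of _ x] q_scale[symmetric])
qed

end

locale algebra_presentation = presentation V q K
  for V :: "('k::field, 'a, 'm) graded_algebra_scheme" and q :: "('v list \<Rightarrow>\<^sub>0 'k) \<Rightarrow> 'a" and K +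
  assumes q_mult: "q (x * y) = q x \<otimes>\<^bsub>V\<^esub> q y"
    and q_one: "q 1 = \<one>\<^bsub>V\<^esub>"
    and q_grade: "grade V n = q ` homog n"
begin

lemma kernel_mult:
  assumes "x \<in> K"
  shows "f * x \<in> K" "x * f \<in> K"
proof -
  have "q x = q 0" using q_eq_iff[of x 0] assms by simp
  then have "q (f * x) = q (f * 0)" "q (x * f) = q (0 * f)"
    by (simp_all only: q_mult)
  then show "f * x \<in> K" "x * f \<in> K"
    using q_eq_iff[of "f * x" "f * 0"] q_eq_iff[of "x * f" "0 * f"] by simp_all
qed

lemma ring: "ring V"
proof (rule ringI)
  show "abelian_group V" by (rule abelian_group)
  show "Group.monoid V"
    by unfold_locales (auto simp: carrier_eq q_mult[symmetric] q_one[symmetric] mult.assoc)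
qed (auto simp: carrier_eq q_mult[symmetric] q_add[symmetric] ring_distribs)

lemma ideal_image:
  assumes "pm.subspace X" "\<And>f x. x \<in> X \<Longrightarrow> f * x \<in> X" "\<And>f x. x \<in> X \<Longrightarrow> x * f \<in> X"
  shows "ideal (q ` X) V"
proof (rule idealI)
  show "ring V" by (rule ring)
  show "subgroup (q ` X) (add_monoid V)"
    using submodule_image[OF assms(1)] by (rule submodule.axioms)
qed (use assms(2,3) in \<open>auto simp: carrier_eq q_mult[symmetric]\<close>)

lemma ideal_vimage:
  assumes "ideal U V"
  shows "pm.subspace {x. q x \<in> U}" "q x \<in> U \<Longrightarrow> q (f * x) \<in> U" "q x \<in> U \<Longrightarrow> q (x * f) \<in> U"
proof -
  interpret ideal U V by fact
  show 1: "q x \<in> U \<Longrightarrow> q (f * x) \<in> U" "q x \<in> U \<Longrightarrow> q (x * f) \<in> U" for x f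
    by (simp_all add: q_mult I_l_closed I_r_closed)
  show "pm.subspace {x. q x \<in> U}"
    by (auto simp: pm.subspace_def q_zero q_add pscale_eq_mult_left 1)
qed

text \<open>The preimage of an ideal is an ideal that contains the generators \<open>G\<close> of
  the kernel, hence all sandwiches of \<open>X\<close> and \<open>G\<close>; conversely these
  sandwiches span an ideal.\<close>

lemma genideal_image:
  assumes K: "K = pm.span (sandwich G)"
  shows "Idl\<^bsub>V\<^esub> (q ` X) = q ` pm.span (sandwich (X \<union> G))"
proof
  interpret ring V by (rule ring)
  show "Idl\<^bsub>V\<^esub> (q ` X) \<subseteq> q ` pm.span (sandwich (X \<union> G))"
  proof (rule genideal_minimal)
    show "ideal (q ` pm.span (sandwich (X \<union> G))) V"
      by (rule ideal_image) (auto intro: sandwich_ideal)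
    show "q ` X \<subseteq> q ` pm.span (sandwich (X \<union> G))"
      using sandwich_superset[of "X \<union> G"] pm.span_superset[of "sandwich (X \<union> G)"] by blast
  qed
  have I: "ideal (Idl\<^bsub>V\<^esub> (q ` X)) V"
    by (rule genideal_ideal) auto
  have "q x \<in> Idl\<^bsub>V\<^esub> (q ` X)" if "x \<in> X \<union> G" for x
    using that
  proof
    assume "x \<in> X"
    moreover have "q ` X \<subseteq> carrier V" by auto
    ultimately show ?thesis using genideal_self by blast
  next
    assume "x \<in> G"
    then have "q x = \<zero>\<^bsub>V\<^esub>"
      using q_eq_zero_iff K sandwich_superset[of G] pm.span_superset by blast
    then show ?thesis using additive_subgroup.zero_closed[OF ideal.axioms(1)[OF I]] by simp
  qed
  then have "sandwich (X \<union> G) \<subseteq> {x. q x \<in> Idl\<^bsub>V\<^esub> (q ` X)}"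
    unfolding sandwich_def using ideal_vimage(3)[OF I ideal_vimage(2)[OF I]] by blast
  then show "q ` pm.span (sandwich (X \<union> G)) \<subseteq> Idl\<^bsub>V\<^esub> (q ` X)"
    using pm.span_minimal[OF _ ideal_vimage(1)[OF I]] by blast
qed

lemma algebra_presentation_quotient:
  assumes X: "pm.subspace X" "K \<subseteq> X" "\<And>f x. x \<in> X \<Longrightarrow> f * x \<in> X" "\<And>f x. x \<in> X \<Longrightarrow> x * f \<in> X"
  shows "algebra_presentation (quotient_algebra V (q ` X)) (\<lambda>x. q ` X +>\<^bsub>V\<^esub> q x) X"
proof -
  let ?Q = "quotient_algebra V (q ` X)" and ?M = "quotient_module V (q ` X)"
  interpret Q: presentation ?M "\<lambda>x. q ` X +>\<^bsub>V\<^esub> q x" X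
    by (rule presentation_quotient[OF X(1,2)])
  have quot: "carrier ?Q = carrier ?M" "\<zero>\<^bsub>?Q\<^esub> = \<zero>\<^bsub>?M\<^esub>" "add ?Q = add ?M" "smult ?Q = smult ?M"
    "grade ?Q = (\<lambda>n. (\<lambda>x. q ` X +>\<^bsub>V\<^esub> x) ` grade V n)"
    "monoid.mult ?Q = rcoset_mult V (q ` X)" "\<one>\<^bsub>?Q\<^esub> = q ` X +>\<^bsub>V\<^esub> \<one>\<^bsub>V\<^esub>"
    by (simp_all add: quotient_algebra_def quotient_module_def ring.defs module.defs
        graded_algebra.defs FactRing_def)
  \<comment> \<open>The product of cosets is a union over pairs of representatives; the difference
    of two products lies in the ideal.\<close>
  have mult: "q ` X +>\<^bsub>V\<^esub> q ((k + x) * (l + y)) = q ` X +>\<^bsub>V\<^esub> q (x * y)"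
    if "k \<in> X" "l \<in> X" for k l x y
  proof -
    have "(k + x) * (l + y) - x * y = k * (l + y) + x * l"
      by (simp add: ring_distribs)
    then show ?thesis
      using that X(3,4) pm.subspace_add[OF X(1)] by (auto simp: Q.q_eq_iff)
  qed
  show ?thesis
  proof
    fix x y
    show "q ` X +>\<^bsub>V\<^esub> q (x * y) = (q ` X +>\<^bsub>V\<^esub> q x) \<otimes>\<^bsub>?Q\<^esub> (q ` X +>\<^bsub>V\<^esub> q y)"
      unfolding quot rcoset_mult_def using mult pm.subspace_0[OF X(1)]
      by (auto simp: coset_eq[of _ x] coset_eq[of _ y] q_mult[symmetric])
  qed (simp_all add: quot Q.carrier_eq Q.q_add Q.q_scale Q.q_zero Q.q_eq_iff q_one[symmetric] q_grade image_image)
qed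

end

section \<open>Presentations of the tensor algebra and of homogeneous algebras on words\<close>

lemma algebra_presentation_free: "algebra_presentation free_algebra (\<lambda>x. x) {0}"
  by unfold_locales (auto simp: free_algebra_def pscale_def homog_def)

definition tensor_class :: "('k::field \<Rightarrow> 'v::ab_group_add \<Rightarrow> 'v) \<Rightarrow> ('v list \<Rightarrow>\<^sub>0 'k) \<Rightarrow> ('k, 'v) tensor" where
  "tensor_class s p = Idl\<^bsub>free_algebra\<^esub> (linear_relations s) +>\<^bsub>free_algebra\<^esub> p"

definition algebra_class :: "('k::field \<Rightarrow> 'v::ab_group_add \<Rightarrow> 'v) \<Rightarrow> ('k, 'v) tensor set
    \<Rightarrow> ('v list \<Rightarrow>\<^sub>0 'k) \<Rightarrow> ('k, 'v) tensor set" where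
  "algebra_class s R p = Idl\<^bsub>tensor_algebra s\<^esub> R +>\<^bsub>tensor_algebra s\<^esub> tensor_class s p"

lemma tensor_incl_eq: "tensor_incl s e = tensor_class s (mon [e])"
  and generator_eq: "generator s R e = algebra_class s R (mon [e])"
  by (simp_all add: tensor_incl_def generator_def tensor_class_def algebra_class_def)

text \<open>The free algebra presents itself with kernel 0, generated by the empty set;
  \<open>genideal_image\<close> then turns the ideal of linear relations into a span of
  sandwiches.\<close>

lemma algebra_presentation_tensor_algebra:
  fixes s :: "'k::field \<Rightarrow> 'v::ab_group_add \<Rightarrow> 'v"
  shows "algebra_presentation (tensor_algebra s) (tensor_class s) (lin_ideal s)"
proof -
  interpret F: algebra_presentation free_algebra "\<lambda>x :: 'v list \<Rightarrow>\<^sub>0 'k. x" "{0}"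
    by (rule algebra_presentation_free)
  have "Idl\<^bsub>free_algebra\<^esub> (linear_relations s) = lin_ideal s"
    using F.genideal_image[of "{}" "linear_relations s"] by (simp add: sandwich_def)
  moreover have "algebra_presentation (quotient_algebra free_algebra ((\<lambda>x. x) ` lin_ideal s))
      (\<lambda>x. (\<lambda>x. x) ` lin_ideal s +>\<^bsub>free_algebra\<^esub> x) (lin_ideal s)"
    by (rule F.algebra_presentation_quotient) (simp_all add: pm.span_zero sandwich_ideal)
  ultimately show ?thesis
    unfolding tensor_algebra_def tensor_class_def[abs_def] by simp
qed

text \<open>The sets \<open>S\<close> that arise from subspaces of the tensor power of order \<open>N\<close>.\<close>

definition relation_space :: "('k::field \<Rightarrow> 'v::ab_group_add \<Rightarrow> 'v) \<Rightarrow> nat \<Rightarrow> ('v list \<Rightarrow>\<^sub>0 'k) set \<Rightarrow> bool" where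
  "relation_space s N S \<longleftrightarrow> pm.subspace S \<and> S \<subseteq> homog N \<and> lin_ideal s \<inter> homog N \<subseteq> S"

lemma algebra_presentation_homogeneous_algebra:
  "algebra_presentation (homogeneous_algebra s (tensor_class s ` S)) (algebra_class s (tensor_class s ` S))
    (relation_ideal s S)"
proof -
  interpret T: algebra_presentation "tensor_algebra s" "tensor_class s" "lin_ideal s"
    by (rule algebra_presentation_tensor_algebra)
  have "lin_ideal s \<subseteq> relation_ideal s S"
    unfolding relation_ideal_def by (intro pm.span_mono sandwich_mono) blast
  then show ?thesis
    unfolding homogeneous_algebra_def algebra_class_def[abs_def] T.genideal_image[OF refl]
      relation_ideal_def[symmetric]
    by (intro T.algebra_presentation_quotient) (simp_all add: relation_ideal_def sandwich_ideal)
qed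

lemma relation_space_of_subspace:
  assumes "linear_subspace R (tensor_algebra s)" "R \<subseteq> tensor_power s N"
  obtains S where "relation_space s N S" "R = tensor_class s ` S"
proof
  interpret T: algebra_presentation "tensor_algebra s" "tensor_class s" "lin_ideal s"
    by (rule algebra_presentation_tensor_algebra)
  note * = T.subspace_vimage_submodule[OF assms(1)]
  \<comment> \<open>Cutting the preimage down to degree \<open>N\<close> loses nothing of
    \<open>R\<close>, which consists of classes of homogeneous elements.\<close>
  let ?S = "{x. tensor_class s x \<in> R} \<inter> homog N"
  show "relation_space s N ?S"
    using *(2) by (auto simp: relation_space_def intro!: pm.subspace_inter *(1) subspace_homog)
  show "R = tensor_class s ` ?S"
    using assms(2) by (auto simp: T.q_grade)
qed

lemma subspace_of_relation_space:
  assumes "relation_space s N S"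
  shows "linear_subspace (tensor_class s ` S) (tensor_algebra s)" "tensor_class s ` S \<subseteq> tensor_power s N"
proof -
  interpret T: algebra_presentation "tensor_algebra s" "tensor_class s" "lin_ideal s"
    by (rule algebra_presentation_tensor_algebra)
  show "linear_subspace (tensor_class s ` S) (tensor_algebra s)" "tensor_class s ` S \<subseteq> tensor_power s N"
    using assms by (auto simp: relation_space_def T.q_grade intro: T.submodule_image)
qed

lemma isos_algebra_presentation:
  assumes "algebra_presentation A p K" "h \<in> graded_algebra_isos A B" "abelian_group B"
  shows "algebra_presentation B (\<lambda>x. h (p x)) K"
proof -
  interpret A: algebra_presentation A p K by fact
  have h: "h \<in> ring_hom A B" "bij_betw h (carrier A) (carrier B)" "h \<in> linear_maps A B"
    "\<And>n. h ` grade A n = grade B n"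
    using assms(2) by (auto simp: graded_algebra_isos_def ring_iso_def)
  have inj: "h (p x) = h (p y) \<longleftrightarrow> p x = p y" for x y
    using bij_betw_imp_inj_on[OF h(2)] by (auto simp: inj_on_def)
  have lin: "h (p (x + y)) = h (p x) \<oplus>\<^bsub>B\<^esub> h (p y)" "h (p (pscale c x)) = c \<odot>\<^bsub>B\<^esub> h (p x)" for x y c
    using h(3) by (simp_all add: linear_maps_def A.q_add A.q_scale)
  show ?thesis
  proof
    show "carrier B = range (\<lambda>x. h (p x))"
      using bij_betw_imp_surj_on[OF h(2)] by (auto simp: A.carrier_eq)
    interpret B: abelian_group B by fact
    \<comment> \<open>\<open>ring_hom\<close> does not list preservation of 0; in the group
      \<open>B\<close> an element equal to its own double is 0.\<close>
    have "h (p 0) \<in> carrier B" "h (p 0) \<oplus>\<^bsub>B\<^esub> h (p 0) = h (p 0)"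
      using bij_betwE[OF h(2)] lin(1)[of 0 0] by auto
    then show "h (p 0) = \<zero>\<^bsub>B\<^esub>" by (metis B.add.l_cancel_one)
  qed (auto simp: lin inj A.q_eq_iff A.q_mult ring_hom_mult[OF h(1)] A.q_one ring_hom_one[OF h(1)] h(4)[symmetric] A.q_grade)
qed


section \<open>Tensor products of presented spaces\<close>

text \<open>\<open>E\<close> has to be onto modulo \<open>K\<close> only. It serves to replace pairs
  of vectors by pairs of words in a tensor product.\<close>

lemma (in presentation) presentation_reparametrize:
  assumes E: "plinear E" and onto: "\<And>p. \<exists>g. p - E g \<in> K"
  shows "presentation V (\<lambda>x. q (E x)) {x. E x \<in> K}"
proof
  show "carrier V = range (\<lambda>x. q (E x))"
    unfolding carrier_eq using onto q_eq_iff by (auto, metis rangeI)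
qed (simp_all add: plinearD[OF E] q_add q_scale q_zero q_eq_iff)

text \<open>The projection onto functions supported in \<open>Z\<close>; it exhibits
  \<open>free_space Z\<close> as a quotient of the free space on the whole type, as
  \<open>presentation\<close> requires.\<close>

definition restrict_keys :: "'z set \<Rightarrow> ('z \<Rightarrow>\<^sub>0 'k::field) \<Rightarrow> ('z \<Rightarrow>\<^sub>0 'k)" where
  "restrict_keys Z = pext pscale (\<lambda>z. if z \<in> Z then mon z else 0)"

lemma plinear_restrict_keys: "plinear (restrict_keys Z)"
  unfolding restrict_keys_def by (rule pm.linear_pext)

lemma restrict_keys_single:
  "restrict_keys Z (Poly_Mapping.single z c) = (if z \<in> Z then Poly_Mapping.single z c else 0)"
  by (simp add: restrict_keys_def)

lemma lookup_restrict_keys: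
  "Poly_Mapping.lookup (restrict_keys Z p) z = (if z \<in> Z then Poly_Mapping.lookup p z else 0)"
  by (induction p rule: poly_mapping_additive_induct)
    (auto simp: plinearD[OF plinear_restrict_keys] lookup_add restrict_keys_single lookup_single when_def)

lemma restrict_keys_ident: "Poly_Mapping.keys p \<subseteq> Z \<Longrightarrow> restrict_keys Z p = p"
  by (rule poly_mapping_eqI) (auto simp: lookup_restrict_keys in_keys_iff)

lemma presentation_free_space:
  "presentation (free_space Z) (restrict_keys Z) {p. restrict_keys Z p = 0}"
proof
  have "Poly_Mapping.keys (restrict_keys Z p) \<subseteq> Z" for p :: "'a \<Rightarrow>\<^sub>0 'b"
    by (auto simp: in_keys_iff lookup_restrict_keys split: if_splits)
  moreover have "p = restrict_keys Z p" if "Poly_Mapping.keys p \<subseteq> Z" for p :: "'a \<Rightarrow>\<^sub>0 'b"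
    using restrict_keys_ident[OF that] by simp
  ultimately show "carrier (free_space Z :: ('b, 'a \<Rightarrow>\<^sub>0 'b) module) = range (restrict_keys Z)"
    by (auto simp: free_space_def)
qed (simp_all add: free_space_def plinearD[OF plinear_restrict_keys] pscale_def[symmetric])

locale presentation_pair = A: presentation V q K + B: presentation W r L
  for V :: "('k::field, 'a, 'm) module_scheme" and q :: "('x \<Rightarrow>\<^sub>0 'k) \<Rightarrow> 'a" and K
    and W :: "('k, 'b, 'n) module_scheme" and r :: "('y \<Rightarrow>\<^sub>0 'k) \<Rightarrow> 'b" and L
begin

definition pairs :: "('x \<times> 'y \<Rightarrow>\<^sub>0 'k) \<Rightarrow> ('a \<times> 'b \<Rightarrow>\<^sub>0 'k)" where
  "pairs = kmap (\<lambda>(u, w). (q (mon u), r (mon w)))"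

text \<open>The second set consists of the functions supported outside the carriers.\<close>

definition pair_relations :: "('a \<times> 'b \<Rightarrow>\<^sub>0 'k) set" where
  "pair_relations = pm.span (bilinear_relations V W \<union> {p. restrict_keys (carrier V \<times> carrier W) p = 0})"

definition tensor_kernel :: "('x \<times> 'y \<Rightarrow>\<^sub>0 'k) set" where
  "tensor_kernel = pm.span ({tens f i | f i. i \<in> L} \<union> {tens i g | i g. i \<in> K})"

definition product_class :: "('x \<times> 'y \<Rightarrow>\<^sub>0 'k) \<Rightarrow> ('a \<times> 'b \<Rightarrow>\<^sub>0 'k) set" where
  "product_class g = bilinear_kernel V W +>\<^bsub>free_space (carrier V \<times> carrier W)\<^esub>
     restrict_keys (carrier V \<times> carrier W) (pairs g)"

lemma plinear_pairs: "plinear pairs"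
  unfolding pairs_def by (rule plinear_kmap)

lemma subspace_pair_relations: "pm.subspace pair_relations"
  by (simp add: pair_relations_def)

lemma bilinear_relations_subset:
  assumes "p \<in> bilinear_relations V W"
  shows "Poly_Mapping.keys p \<subseteq> carrier V \<times> carrier W"
proof -
  interpret VM: Module.module scalars V by (rule A.module_scalars)
  interpret WM: Module.module scalars W by (rule B.module_scalars)
  have [simp]: "c \<in> carrier scalars" for c :: 'k by (simp add: scalars_def)
  show ?thesis
    using assms unfolding bilinear_relations_def
    by (auto simp: in_keys_iff lookup_minus lookup_single when_def split: if_splits)
qed

lemma presentation_pairs:
  "presentation (tensor_product V W)
     (\<lambda>p. bilinear_kernel V W +>\<^bsub>free_space (carrier V \<times> carrier W)\<^esub>
       restrict_keys (carrier V \<times> carrier W) p) pair_relations"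
proof -
  let ?Z = "carrier V \<times> carrier W"
  interpret F: presentation "free_space ?Z" "restrict_keys ?Z" "{p. restrict_keys ?Z p = 0}"
    by (rule presentation_free_space)
  have "restrict_keys ?Z ` bilinear_relations V W = (\<lambda>p. p) ` bilinear_relations V W"
    by (rule image_cong[OF refl]) (rule restrict_keys_ident[OF bilinear_relations_subset])
  then have "bilinear_kernel V W = restrict_keys ?Z ` pair_relations"
    using F.span_in_image[of "bilinear_relations V W"]
    by (simp add: bilinear_kernel_def pair_relations_def F.image_span_kernel)
  moreover have "{p. restrict_keys ?Z p = 0} \<subseteq> pair_relations"
    unfolding pair_relations_def by (intro order.trans[OF _ pm.span_superset]) blast
  ultimately show ?thesis
    using F.presentation_quotient[OF subspace_pair_relations] by (simp add: tensor_product_def)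
qed

lemma bilinear_relation:
  "mon (q f \<oplus>\<^bsub>V\<^esub> q f', r g) - mon (q f, r g) - mon (q f', r g) \<in> pair_relations"
  "mon (q f, r g \<oplus>\<^bsub>W\<^esub> r g') - mon (q f, r g) - mon (q f, r g') \<in> pair_relations"
  "mon (c \<odot>\<^bsub>V\<^esub> q f, r g) - Poly_Mapping.single (q f, r g) c \<in> pair_relations"
  "mon (q f, c \<odot>\<^bsub>W\<^esub> r g) - Poly_Mapping.single (q f, r g) c \<in> pair_relations"
proof -
  have "bilinear_relations V W \<subseteq> pair_relations"
    unfolding pair_relations_def by (intro order.trans[OF _ pm.span_superset]) blast
  note * = subsetD[OF this, unfolded bilinear_relations_def]
  show "mon (q f \<oplus>\<^bsub>V\<^esub> q f', r g) - mon (q f, r g) - mon (q f', r g) \<in> pair_relations"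
    by (rule *, intro UnI1 CollectI exI conjI) (rule refl A.q_in_carrier B.q_in_carrier)+
  show "mon (q f, r g \<oplus>\<^bsub>W\<^esub> r g') - mon (q f, r g) - mon (q f, r g') \<in> pair_relations"
    by (rule *, rule UnI1, rule UnI1, rule UnI2, intro CollectI exI conjI)
      (rule refl A.q_in_carrier B.q_in_carrier)+
  show "mon (c \<odot>\<^bsub>V\<^esub> q f, r g) - Poly_Mapping.single (q f, r g) c \<in> pair_relations"
    by (rule *, rule UnI1, rule UnI2, intro CollectI exI conjI)
      (rule refl A.q_in_carrier B.q_in_carrier)+
  show "mon (q f, c \<odot>\<^bsub>W\<^esub> r g) - Poly_Mapping.single (q f, r g) c \<in> pair_relations"
    by (rule *, rule UnI2, intro CollectI exI conjI) (rule refl A.q_in_carrier B.q_in_carrier)+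
qed

text \<open>Bilinearity expands the two classes into words, one factor at a time:
  \<open>word\<close> treats \<open>g\<close> behind a single word, the outer induction treats
  \<open>f\<close>.\<close>

lemma mon_pair_sub_pairs_tens: "mon (q f, r g) - pairs (tens f g) \<in> pair_relations"
proof -
  note add = pm.subspace_add[OF subspace_pair_relations]
    and scale = pm.subspace_scale[OF subspace_pair_relations]
  have zero: "mon (q 0, r g) \<in> pair_relations" "mon (q f, r 0) \<in> pair_relations" for f g
    using bilinear_relation(3)[of 0 0 g] bilinear_relation(4)[of f 0 0]
    by (simp_all add: A.q_scale[symmetric] B.q_scale[symmetric])
  have word: "mon (q (mon u), r g) - pairs (tens (mon u) g) \<in> pair_relations" for u g
  proof (induction g rule: poly_mapping_additive_induct)
    case 1
    then show ?case using zero by (simp add: tens_linear plinearD[OF plinear_pairs])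
  next
    case (2 g g')
    from add[OF add[OF bilinear_relation(2)[of "mon u" g g'] 2(1)] 2(2)]
    show ?case unfolding B.q_add by (simp add: tens_linear plinearD[OF plinear_pairs] algebra_simps)
  next
    case (3 w c)
    have "r (Poly_Mapping.single w c) = c \<odot>\<^bsub>W\<^esub> r (mon w)"
      by (simp add: B.q_scale[symmetric])
    then show ?case using bilinear_relation(4)[of "mon u" c "mon w"] by (simp add: pairs_def)
  qed
  show ?thesis
  proof (induction f rule: poly_mapping_additive_induct)
    case 1
    then show ?case using zero by (simp add: tens_linear plinearD[OF plinear_pairs])
  next
    case (2 f f')
    from add[OF add[OF bilinear_relation(1)[of f f' g] 2(1)] 2(2)]
    show ?case unfolding A.q_add by (simp add: tens_linear plinearD[OF plinear_pairs] algebra_simps)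
  next
    case (3 u c)
    have *: "q (Poly_Mapping.single u c) = c \<odot>\<^bsub>V\<^esub> q (mon u)"
      by (simp add: A.q_scale[symmetric])
    have **: "pairs (tens (Poly_Mapping.single u c) g) = pscale c (pairs (tens (mon u) g))"
      using tens_linear(2)[of c "mon u" g] by (simp add: plinearD[OF plinear_pairs])
    show ?case
      using add[OF bilinear_relation(3)[of c "mon u" g] scale[OF word[of u g], of c]]
      by (simp add: * ** pm.scale_right_diff_distrib)
  qed
qed

lemma tens_diff_mem_kernel:
  assumes "f - f' \<in> K" "g - g' \<in> L"
  shows "tens f g - tens f' g' \<in> tensor_kernel"
proof -
  have "tens f g - tens f' g' = tens (f - f') g + tens f' (g - g')"
    by (simp add: tens_linear)
  moreover have "tens (f - f') g \<in> tensor_kernel" "tens f' (g - g') \<in> tensor_kernel"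
    unfolding tensor_kernel_def using assms by (blast intro: pm.span_base)+
  ultimately show ?thesis
    unfolding tensor_kernel_def by (simp add: pm.span_add)
qed

text \<open>A left inverse of \<open>pairs\<close> modulo \<open>tensor_kernel\<close>; another
  choice of representatives changes a value by a kernel element. The value 0 off the carriers makes
  it vanish on what \<open>restrict_keys\<close> kills.\<close>

definition lift_pairs :: "('a \<times> 'b \<Rightarrow>\<^sub>0 'k) \<Rightarrow> ('x \<times> 'y \<Rightarrow>\<^sub>0 'k)" where
  "lift_pairs = pext pscale (\<lambda>(v, w). if v \<in> carrier V \<and> w \<in> carrier W
     then tens (SOME f. q f = v) (SOME g. r g = w) else 0)"

lemma plinear_lift_pairs: "plinear lift_pairs"
  unfolding lift_pairs_def by (rule pm.linear_pext)

lemma lift_pairs_mon: "lift_pairs (mon (q f, r g)) - tens f g \<in> tensor_kernel"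
proof -
  have "q (SOME f'. q f' = q f) = q f" "r (SOME g'. r g' = r g) = r g"
    by (rule someI_ex, blast)+
  then show ?thesis
    by (auto simp: lift_pairs_def A.q_eq_iff B.q_eq_iff intro: tens_diff_mem_kernel)
qed

lemma lift_pairs_pairs: "lift_pairs (pairs g) - g \<in> tensor_kernel"
proof -
  have lin: "plinear (\<lambda>g. lift_pairs (pairs g) - g)"
    by (rule plinearI) (simp_all add: plinearD[OF plinear_lift_pairs] plinearD[OF plinear_pairs]
        pm.scale_right_diff_distrib)
  have "g \<in> {g. lift_pairs (pairs g) - g \<in> tensor_kernel}"
  proof (rule subspace_eq_UNIV_I)
    show "pm.subspace {g. lift_pairs (pairs g) - g \<in> tensor_kernel}"
      by (rule subspace_vimage[OF lin]) (simp add: tensor_kernel_def)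
    show "mon k \<in> {g. lift_pairs (pairs g) - g \<in> tensor_kernel}" for k
      using lift_pairs_mon[of "mon (fst k)" "mon (snd k)"] by (simp add: pairs_def case_prod_beta)
  qed
  then show ?thesis by simp
qed

text \<open>Up to \<open>tensor_kernel\<close> the lift of a pair is \<open>tens\<close>, which is
  bilinear, so each bilinear relation is lifted into the kernel.\<close>

lemma lift_pairs_relations:
  assumes "p \<in> pair_relations"
  shows "lift_pairs p \<in> tensor_kernel"
proof (rule span_image_subset[OF plinear_lift_pairs])
  show "p \<in> pm.span (bilinear_relations V W \<union> {p. restrict_keys (carrier V \<times> carrier W) p = 0})"
    using assms by (simp add: pair_relations_def)
  show sub: "pm.subspace tensor_kernel" by (simp add: tensor_kernel_def)
  let ?l = "\<lambda>f g. lift_pairs (mon (q f, r g))"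
  have eq: "?l f g - tens f g \<in> tensor_kernel" for f g by (rule lift_pairs_mon)
  have scale: "pscale c (?l f g - tens f g) \<in> tensor_kernel" for c f g
    by (rule pm.subspace_scale[OF sub eq])
  have lin: "lift_pairs (Poly_Mapping.single k c) = pscale c (lift_pairs (mon k))" for k c
    using plinearD(2)[OF plinear_lift_pairs, of c "mon k"] by simp
  note diff = pm.subspace_diff[OF sub]
  have add1: "?l (f + f') g - ?l f g - ?l f' g \<in> tensor_kernel" for f f' g
    using diff[OF diff[OF eq[of "f + f'" g] eq[of f g]] eq[of f' g]]
    by (simp add: tens_linear algebra_simps)
  have add2: "?l f (g + g') - ?l f g - ?l f g' \<in> tensor_kernel" for f g g'
    using diff[OF diff[OF eq[of f "g + g'"] eq[of f g]] eq[of f g']]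
    by (simp add: tens_linear algebra_simps)
  have scale1: "?l (pscale c f) g - pscale c (?l f g) \<in> tensor_kernel" for c f g
    using diff[OF eq[of "pscale c f" g] scale[of c f g]]
    by (simp add: tens_linear pm.scale_right_diff_distrib)
  have scale2: "?l f (pscale c g) - pscale c (?l f g) \<in> tensor_kernel" for c f g
    using diff[OF eq[of f "pscale c g"] scale[of c f g]]
    by (simp add: tens_linear pm.scale_right_diff_distrib)
  fix x assume "x \<in> bilinear_relations V W \<union> {p. restrict_keys (carrier V \<times> carrier W) p = 0}"
  then show "lift_pairs x \<in> tensor_kernel"
  proof
    assume "x \<in> bilinear_relations V W"
    then show ?thesis
      unfolding bilinear_relations_def
    proof (elim UnE CollectE exE conjE)
      fix v v' w
      assume x: "x = mon (v \<oplus>\<^bsub>V\<^esub> v', w) - mon (v, w) - mon (v', w)"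
        and "v \<in> carrier V" "v' \<in> carrier V" "w \<in> carrier W"
      then obtain f f' g where "v = q f" "v' = q f'" "w = r g"
        by (auto simp: A.carrier_eq B.carrier_eq)
      then show ?thesis
        unfolding x by (simp only: A.q_add[symmetric] plinearD(4)[OF plinear_lift_pairs] add1)
    next
      fix v w w'
      assume x: "x = mon (v, w \<oplus>\<^bsub>W\<^esub> w') - mon (v, w) - mon (v, w')"
        and "v \<in> carrier V" "w \<in> carrier W" "w' \<in> carrier W"
      then obtain f g g' where "v = q f" "w = r g" "w' = r g'"
        by (auto simp: A.carrier_eq B.carrier_eq)
      then show ?thesis
        unfolding x by (simp only: B.q_add[symmetric] plinearD(4)[OF plinear_lift_pairs] add2)
    next
      fix c v w
      assume x: "x = mon (c \<odot>\<^bsub>V\<^esub> v, w) - Poly_Mapping.single (v, w) c"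
        and "v \<in> carrier V" "w \<in> carrier W"
      then obtain f g where "v = q f" "w = r g"
        by (auto simp: A.carrier_eq B.carrier_eq)
      then show ?thesis
        unfolding x by (simp only: A.q_scale[symmetric] plinearD(4)[OF plinear_lift_pairs] lin[of _ c] scale1)
    next
      fix c v w
      assume x: "x = mon (v, c \<odot>\<^bsub>W\<^esub> w) - Poly_Mapping.single (v, w) c"
        and "v \<in> carrier V" "w \<in> carrier W"
      then obtain f g where "v = q f" "w = r g"
        by (auto simp: A.carrier_eq B.carrier_eq)
      then show ?thesis
        unfolding x by (simp only: B.q_scale[symmetric] plinearD(4)[OF plinear_lift_pairs] lin[of _ c] scale2)
    qed
  next
    assume x: "x \<in> {p. restrict_keys (carrier V \<times> carrier W) p = 0}"
    have "(\<lambda>p. lift_pairs (restrict_keys (carrier V \<times> carrier W) p)) = lift_pairs"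
    proof (rule linear_mon_eqI)
      show "plinear (\<lambda>p. lift_pairs (restrict_keys (carrier V \<times> carrier W) p))"
        by (rule plinear_comp[OF plinear_restrict_keys plinear_lift_pairs])
      show "plinear lift_pairs" by (rule plinear_lift_pairs)
      show "lift_pairs (restrict_keys (carrier V \<times> carrier W) (mon k)) = lift_pairs (mon k)" for k
      proof (cases "k \<in> carrier V \<times> carrier W")
        case False
        then have "lift_pairs (mon k) = 0" by (cases k) (auto simp: lift_pairs_def)
        then show ?thesis
          using False by (simp add: restrict_keys_single plinearD(3)[OF plinear_lift_pairs])
      qed (simp add: restrict_keys_single)
    qed
    then have "lift_pairs x = lift_pairs (restrict_keys (carrier V \<times> carrier W) x)"
      by metis
    then show ?thesis
      using x by (simp add: plinearD[OF plinear_lift_pairs] pm.subspace_0[OF sub])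
  qed
qed

text \<open>Identifies the kernel of a tensor product of quotients. That it is no larger follows
  from \<open>lift_pairs\<close>, which undoes \<open>pairs\<close> modulo
  \<open>tensor_kernel\<close>.\<close>

lemma pairs_mem_relations_iff: "pairs g \<in> pair_relations \<longleftrightarrow> g \<in> tensor_kernel"
proof
  assume "pairs g \<in> pair_relations"
  then have "lift_pairs (pairs g) \<in> tensor_kernel" by (rule lift_pairs_relations)
  from pm.subspace_diff[OF _ this lift_pairs_pairs[of g]] show "g \<in> tensor_kernel"
    by (simp add: tensor_kernel_def)
next
  assume g: "g \<in> tensor_kernel"
  have eqI: "pairs (tens f g) \<in> pair_relations" if "mon (q f, r g) \<in> pair_relations" for f g
    using pm.subspace_diff[OF subspace_pair_relations that mon_pair_sub_pairs_tens[of f g]] by simp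
  show "pairs g \<in> pair_relations"
  proof (rule span_image_subset[OF plinear_pairs subspace_pair_relations])
    show "g \<in> pm.span ({tens f i | f i. i \<in> L} \<union> {tens i g | i g. i \<in> K})"
      using g by (simp add: tensor_kernel_def)
    fix x assume "x \<in> {tens f i | f i. i \<in> L} \<union> {tens i g | i g. i \<in> K}"
    then show "pairs x \<in> pair_relations"
    proof
      assume "x \<in> {tens f i | f i. i \<in> L}"
      then obtain f i where x: "x = tens f i" "i \<in> L" by blast
      \<comment> \<open>An element of \<open>L\<close> has class 0, and a pair with a zero entry is
        the scaling relation for the scalar 0.\<close>
      then have "r i = r 0" using B.q_eq_iff[of i 0] by simp
      then show ?thesis
        using bilinear_relation(4)[of f 0 i] unfolding x(1)
        by (intro eqI) (simp add: B.q_scale[symmetric])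
    next
      assume "x \<in> {tens i g | i g. i \<in> K}"
      then obtain g i where x: "x = tens i g" "i \<in> K" by blast
      then have "q i = q 0" using A.q_eq_iff[of i 0] by simp
      then show ?thesis
        using bilinear_relation(3)[of 0 i g] unfolding x(1)
        by (intro eqI) (simp add: A.q_scale[symmetric])
    qed
  qed
qed

lemma presentation_tensor_product: "presentation (tensor_product V W) product_class tensor_kernel"
proof -
  interpret Q: presentation "tensor_product V W" "\<lambda>p. bilinear_kernel V W
      +>\<^bsub>free_space (carrier V \<times> carrier W)\<^esub> restrict_keys (carrier V \<times> carrier W) p" pair_relations
    by (rule presentation_pairs)
  \<comment> \<open>Surjectivity modulo the relations: pairs of carrier elements expand into words,
    all other pairs are relations themselves.\<close>
  have "p \<in> {p. \<exists>g. p - pairs g \<in> pair_relations}" for p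
  proof (rule subspace_eq_UNIV_I)
    show "pm.subspace {p. \<exists>g. p - pairs g \<in> pair_relations}"
      unfolding pm.subspace_def
    proof (intro conjI ballI allI)
      show "0 \<in> {p. \<exists>g. p - pairs g \<in> pair_relations}"
        by (auto intro!: exI[of _ 0] simp: plinearD[OF plinear_pairs] pm.subspace_0[OF subspace_pair_relations])
    next
      fix x y assume "x \<in> {p. \<exists>g. p - pairs g \<in> pair_relations}" "y \<in> {p. \<exists>g. p - pairs g \<in> pair_relations}"
      then obtain g h where "x - pairs g \<in> pair_relations" "y - pairs h \<in> pair_relations" by blast
      from pm.subspace_add[OF subspace_pair_relations this]
      show "x + y \<in> {p. \<exists>g. p - pairs g \<in> pair_relations}"
        by (auto intro!: exI[of _ "g + h"] simp: plinearD[OF plinear_pairs] algebra_simps)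
    next
      fix c x assume "x \<in> {p. \<exists>g. p - pairs g \<in> pair_relations}"
      then obtain g where "x - pairs g \<in> pair_relations" by blast
      from pm.subspace_scale[OF subspace_pair_relations this, of c]
      show "pscale c x \<in> {p. \<exists>g. p - pairs g \<in> pair_relations}"
        by (auto intro!: exI[of _ "pscale c g"] simp: plinearD[OF plinear_pairs] pm.scale_right_diff_distrib)
    qed
    fix k :: "'a \<times> 'b"
    show "mon k \<in> {p. \<exists>g. p - pairs g \<in> pair_relations}"
    proof (cases "k \<in> carrier V \<times> carrier W")
      case True
      then obtain f g where "k = (q f, r g)" by (auto simp: A.carrier_eq B.carrier_eq)
      then show ?thesis using mon_pair_sub_pairs_tens[of f g] by blast
    next
      case False
      then have "mon k - pairs 0 \<in> {p. restrict_keys (carrier V \<times> carrier W) p = 0}"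
        by (auto simp: restrict_keys_single plinearD[OF plinear_pairs])
      then have "mon k - pairs 0 \<in> pair_relations"
        unfolding pair_relations_def by (intro pm.span_base UnI2)
      then show ?thesis by blast
    qed
  qed
  from Q.presentation_reparametrize[OF plinear_pairs] this
  have "presentation (tensor_product V W) product_class {x. pairs x \<in> pair_relations}"
    unfolding product_class_def[abs_def] by blast
  then show ?thesis by (simp add: pairs_mem_relations_iff)
qed

lemma pure_tensor_eq: "pure_tensor V W (q f) (r g) = product_class (tens f g)"
proof -
  interpret Q: presentation "tensor_product V W" "\<lambda>p. bilinear_kernel V W
      +>\<^bsub>free_space (carrier V \<times> carrier W)\<^esub> restrict_keys (carrier V \<times> carrier W) p" pair_relations
    by (rule presentation_pairs)
  have "pure_tensor V W (q f) (r g) = bilinear_kernel V W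
      +>\<^bsub>free_space (carrier V \<times> carrier W)\<^esub> restrict_keys (carrier V \<times> carrier W) (mon (q f, r g))"
    by (simp add: pure_tensor_def restrict_keys_single)
  also have "\<dots> = product_class (tens f g)"
    unfolding product_class_def Q.q_eq_iff by (rule mon_pair_sub_pairs_tens)
  finally show ?thesis .
qed

end


section \<open>The Koszul complex in terms of the free algebra\<close>

text \<open>Stated for any \<open>p\<close> of degree one and not just a letter, so that a linear
  relation can be moved across the tensor sign as a whole.\<close>

lemma free_d_tens_mult:
  assumes "p \<in> homog 1"
  shows "free_d (tens f (p * g)) = tens (f * p) g"
proof (rule homog_eqI[OF _ _ _ assms])
  show "plinear (\<lambda>p. free_d (tens f (p * g)))"
    by (intro plinear_comp[OF plinear_mult_right] plinear_comp[OF plinear_tens_right] plinear_free_d)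
  show "plinear (\<lambda>p. tens (f * p) g)"
    by (rule plinear_comp[OF plinear_mult_left plinear_tens_left])
  fix w :: "'a list" assume "length w = 1"
  then obtain e where w: "w = [e]" by (auto simp: length_Suc_conv)
  have lin: "plinear (\<lambda>f. free_d (tens f (mon w * g)))" "plinear (\<lambda>f. tens (f * mon w) g)" for g :: "'a list \<Rightarrow>\<^sub>0 'b"
    by (rule plinear_comp[OF plinear_tens_left plinear_free_d] plinear_comp[OF plinear_mult_right plinear_tens_left])+
  have "(\<lambda>f. free_d (tens f (mon w * g))) = (\<lambda>f. tens (f * mon w) g)"
  proof (rule linear_mon_eqI[OF lin])
    fix u :: "'a list"
    show "free_d (tens (mon u) (mon w * g)) = tens (mon u * mon w) g"
      by (induction g rule: poly_mapping_additive_induct)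
        (simp_all add: tens_linear ring_distribs plinearD[OF plinear_free_d] mult_single plus_list_def w)
  qed
  then show "free_d (tens f (mon w * g)) = tens (f * mon w) g" by (rule fun_cong)
qed

lemma free_d_tens_one: "free_d (tens f 1) = 0"
proof -
  have "(\<lambda>f :: 'a list \<Rightarrow>\<^sub>0 'b. free_d (tens f 1)) = (\<lambda>f. 0)"
    by (rule linear_mon_eqI[OF plinear_comp[OF plinear_tens_left plinear_free_d] plinearI])
      (simp_all add: one_eq_mon)
  then show ?thesis by (rule fun_cong)
qed

context vector_space
begin

lemma lin_ideal_subset_relation_ideal: "lin_ideal scale \<subseteq> relation_ideal scale S"
  unfolding relation_ideal_def by (intro pm.span_mono sandwich_mono) blast

text \<open>This makes d well defined on classes. A linear relation at the front of the right factor
  moves as a whole to the left, where it lies in the relation ideal; elsewhere a letter moves and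
  the relation stays on the right. Relations on the left survive since the ideal is closed under
  right multiplication.\<close>

lemma free_d_koszul_kernel:
  assumes "x \<in> koszul_kernel scale S"
  shows "free_d x \<in> koszul_kernel scale S"
proof (rule span_image_subset[OF plinear_free_d])
  show sub: "pm.subspace (koszul_kernel scale S)" by (simp add: koszul_kernel_def)
  show "x \<in> pm.span ({tens f i | f i. i \<in> lin_ideal scale} \<union> {tens i g | i g. i \<in> relation_ideal scale S})"
    using assms by (simp add: koszul_kernel_def)
  have right: "tens f i \<in> koszul_kernel scale S" if "i \<in> lin_ideal scale" for f i
    unfolding koszul_kernel_def using that by (intro pm.span_base) blast
  have left: "tens i g \<in> koszul_kernel scale S" if "i \<in> relation_ideal scale S" for g i
    unfolding koszul_kernel_def using that by (intro pm.span_base) blast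
  fix x assume "x \<in> {tens f i | f i. i \<in> lin_ideal scale} \<union> {tens i g | i g. i \<in> relation_ideal scale S}"
  then show "free_d x \<in> koszul_kernel scale S"
  proof
    assume "x \<in> {tens f i | f i. i \<in> lin_ideal scale}"
    then obtain f i where x: "x = tens f i" "i \<in> lin_ideal scale" by blast
    show ?thesis
      unfolding x(1)
    proof (rule span_image_subset[OF plinear_comp[OF plinear_tens_right plinear_free_d] sub _ x(2)])
      fix y assume "y \<in> sandwich (linear_relations scale)"
      then obtain u z v where y: "y = mon u * z * mon v" "z \<in> linear_relations scale"
        by (auto simp: sandwich_def)
      have z: "z \<in> lin_ideal scale"
        using sandwich_superset y(2) by (intro pm.span_base) blast
      show "free_d (tens f y) \<in> koszul_kernel scale S"
      proof (cases u)
        case Nil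
        then have "free_d (tens f y) = tens (f * z) (mon v)"
          by (simp add: y(1) one_eq_mon[symmetric] free_d_tens_mult[OF lin_rel_homog[OF y(2)]])
        then show ?thesis
          using left[OF subsetD[OF lin_ideal_subset_relation_ideal sandwich_ideal(1)[OF z]]] by simp
      next
        case (Cons e u')
        then have "y = mon [e] * (mon u' * z * mon v)"
          by (simp add: y(1) mon_append[of "[e]" u', simplified] mult.assoc)
        then have "free_d (tens f y) = tens (f * mon [e]) (mon u' * z * mon v)"
          by (simp add: free_d_tens_mult mon_in_homog)
        then show ?thesis
          using right[OF sandwich_ideal(2)[OF sandwich_ideal(1)[OF z]]] by simp
      qed
    qed
  next
    assume "x \<in> {tens i g | i g. i \<in> relation_ideal scale S}"
    then obtain i g where x: "x = tens i g" "i \<in> relation_ideal scale S" by blast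
    have "free_d (tens i (mon w)) \<in> koszul_kernel scale S" for w
    proof (cases w)
      case Nil
      then show ?thesis
        by (simp add: one_eq_mon[symmetric] free_d_tens_one pm.subspace_0[OF sub])
    next
      case (Cons e w')
      then have w: "mon w = mon [e] * mon w'" by (simp add: mon_append[of "[e]" w', simplified])
      have "i * mon [e] \<in> relation_ideal scale S"
        using x(2) unfolding relation_ideal_def by (rule sandwich_ideal(2))
      then show ?thesis
        unfolding w by (subst free_d_tens_mult) (simp_all add: mon_in_homog left)
    qed
    then show ?thesis
      unfolding x(1)
      using tens_subspaceI2[where p = i and q = g, OF subspace_vimage[OF plinear_free_d sub]] by blast
  qed
qed

end

section \<open>The Koszul complex of A(E,R) on representatives\<close>

locale koszul_presentation = vector_space scale
  for scale :: "'k::field \<Rightarrow> 'v::ab_group_add \<Rightarrow> 'v" +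
  fixes N :: nat and S :: "('v list \<Rightarrow>\<^sub>0 'k) set"
  assumes S: "relation_space scale N S"
begin

abbreviation "relations \<equiv> tensor_class scale ` S"
abbreviation "hclass \<equiv> algebra_class scale relations"
abbreviation "tclass \<equiv> tensor_class scale"

end

sublocale koszul_presentation \<subseteq> T: algebra_presentation "tensor_algebra scale" tclass "lin_ideal scale"
  by (rule algebra_presentation_tensor_algebra)

sublocale koszul_presentation \<subseteq> H: algebra_presentation "homogeneous_algebra scale relations" hclass
    "relation_ideal scale S"
  by (rule algebra_presentation_homogeneous_algebra)

sublocale koszul_presentation \<subseteq> HT: presentation_pair "homogeneous_algebra scale relations" hclass
    "relation_ideal scale S" "tensor_algebra scale" tclass "lin_ideal scale"
  by unfold_locales

context koszul_presentation
begin

lemma tensor_kernel_eq: "HT.tensor_kernel = koszul_kernel scale S"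
  by (simp add: HT.tensor_kernel_def koszul_kernel_def)

abbreviation "kclass \<equiv> HT.product_class"

end

sublocale koszul_presentation \<subseteq> C: presentation "koszul_ambient scale relations" kclass "koszul_kernel scale S"
  using HT.presentation_tensor_product by (simp add: tensor_kernel_eq)

context koszul_presentation
begin

text \<open>The map induced by \<open>free_d\<close> meets the specification, so the chosen map
  meets it too. Its values on words are then forced, and linearity extends the equality to all
  classes.\<close>

lemma koszul_d_kclass: "koszul_d scale relations (kclass x) = kclass (free_d x)"
proof -
  let ?A = "homogeneous_algebra scale relations" and ?T = "tensor_algebra scale"
    and ?C = "koszul_ambient scale relations"
  define P where "P D \<longleftrightarrow> D \<in> linear_maps ?C ?C \<and> (\<forall>a\<in>carrier ?A.
     D (koszul_tensor scale relations a \<one>\<^bsub>?T\<^esub>) = \<zero>\<^bsub>?C\<^esub> \<and>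
     (\<forall>e. \<forall>t\<in>carrier ?T. D (koszul_tensor scale relations a (tensor_incl scale e \<otimes>\<^bsub>?T\<^esub> t)) =
        koszul_tensor scale relations (a \<otimes>\<^bsub>?A\<^esub> generator scale relations e) t))" for D
  \<comment> \<open>The representative is arbitrary; \<open>free_d_koszul_kernel\<close> makes the
    resulting class independent of it.\<close>
  define D where "D X = kclass (free_d (SOME x. kclass x = X))" for X
  have D: "D (kclass x) = kclass (free_d x)" for x
  proof -
    have "kclass (SOME y. kclass y = kclass x) = kclass x" by (rule someI_ex) blast
    then have "free_d ((SOME y. kclass y = kclass x) - x) \<in> koszul_kernel scale S"
      by (intro free_d_koszul_kernel) (simp add: C.q_eq_iff)
    then show ?thesis unfolding D_def C.q_eq_iff by (simp add: plinearD[OF plinear_free_d])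
  qed
  have "P D"
    unfolding P_def
  proof (intro conjI ballI allI)
    show "D \<in> linear_maps ?C ?C"
      by (auto simp: linear_maps_def C.carrier_eq C.q_add[symmetric] C.q_scale[symmetric] D
          plinearD[OF plinear_free_d])
    fix a assume "a \<in> carrier ?A"
    then obtain f where f: "a = hclass f" by (auto simp: H.carrier_eq)
    show "D (koszul_tensor scale relations a \<one>\<^bsub>?T\<^esub>) = \<zero>\<^bsub>?C\<^esub>"
      by (simp add: f T.q_one[symmetric] HT.pure_tensor_eq D free_d_tens_one C.q_zero)
    fix e t assume "t \<in> carrier ?T"
    then obtain g where g: "t = tclass g" by (auto simp: T.carrier_eq)
    show "D (koszul_tensor scale relations a (tensor_incl scale e \<otimes>\<^bsub>?T\<^esub> t)) =
        koszul_tensor scale relations (a \<otimes>\<^bsub>?A\<^esub> generator scale relations e) t"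
      by (simp add: f g tensor_incl_eq generator_eq T.q_mult[symmetric] H.q_mult[symmetric]
          HT.pure_tensor_eq D free_d_tens_mult mon_in_homog)
  qed
  moreover have "koszul_d scale relations = (SOME D. P D)"
    unfolding koszul_d_def P_def ..
  ultimately have P: "P (koszul_d scale relations)"
    by (simp only: someI[of P])
  then have lin: "koszul_d scale relations \<in> linear_maps ?C ?C" by (simp add: P_def)
  let ?d = "koszul_d scale relations"
  have add: "?d (kclass (x + y)) = ?d (kclass x) \<oplus>\<^bsub>?C\<^esub> ?d (kclass y)"
    and sc: "?d (kclass (pscale c x)) = c \<odot>\<^bsub>?C\<^esub> ?d (kclass x)" for x y c
    using lin by (simp_all add: linear_maps_def C.q_add C.q_scale)
  have word: "?d (kclass (mon (u, w))) = kclass (free_d (mon (u, w)))" for u w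
  proof (cases w)
    case Nil
    have "kclass (mon (u, w)) = koszul_tensor scale relations (hclass (mon u)) \<one>\<^bsub>?T\<^esub>"
      unfolding T.q_one[symmetric] HT.pure_tensor_eq by (simp add: Nil one_eq_mon)
    then show ?thesis
      using P by (simp add: P_def Nil C.q_zero)
  next
    case (Cons e w')
    have "kclass (mon (u, w)) =
        koszul_tensor scale relations (hclass (mon u)) (tensor_incl scale e \<otimes>\<^bsub>?T\<^esub> tclass (mon w'))"
      unfolding tensor_incl_eq T.q_mult[symmetric] HT.pure_tensor_eq
      by (simp add: Cons mult_single plus_list_def)
    then have "?d (kclass (mon (u, w))) =
        koszul_tensor scale relations (hclass (mon u) \<otimes>\<^bsub>?A\<^esub> generator scale relations e) (tclass (mon w'))"
      using P by (simp add: P_def)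
    then show ?thesis
      unfolding generator_eq H.q_mult[symmetric] HT.pure_tensor_eq
      by (simp add: Cons mult_single plus_list_def)
  qed
  show ?thesis
  proof (induction x rule: poly_mapping_additive_induct)
    case 1
    \<comment> \<open>\<open>linear_maps\<close> lists additivity and scaling only; the value at 0
      comes from scaling by the scalar 0.\<close>
    have "?d (kclass 0) \<in> carrier ?C"
      using lin C.q_in_carrier unfolding linear_maps_def by blast
    then obtain y where y: "?d (kclass 0) = kclass y" unfolding C.carrier_eq by blast
    have "?d (kclass 0) = 0 \<odot>\<^bsub>?C\<^esub> kclass y"
      using sc[of 0 0] y by simp
    also have "\<dots> = kclass 0"
      unfolding C.q_scale[symmetric] by simp
    finally show ?case by (simp add: plinearD(3)[OF plinear_free_d])
  next
    case (2 x y)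
    then show ?case by (simp add: add C.q_add[symmetric] plinearD[OF plinear_free_d])
  next
    case (3 k c)
    then show ?case
      using sc[of c "mon k"] word[of "fst k" "snd k"] plinearD(2)[OF plinear_free_d, of c "mon k"]
      by (simp add: C.q_scale)
  qed
qed

lemma koszul_differential_kclass:
  "koszul_differential scale N relations j (kclass x) = kclass (free_differential N j x)"
proof -
  have "(koszul_d scale relations ^^ n) (kclass x) = kclass ((free_d ^^ n) x)" for n
    by (induction n) (simp_all add: koszul_d_kclass)
  then show ?thesis by (simp add: koszul_differential_def free_differential_def koszul_d_kclass)
qed

text \<open>Tensor powers provide arbitrary homogeneous outer factors, \<open>free_dual\<close> only
  words; linearity in each outer factor reconciles the two.\<close>

lemma sandwich_homog_span:
  "pm.span {f * x * g | f x g. f \<in> homog r \<and> x \<in> S \<and> g \<in> homog t} =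
   pm.span {mon u * x * mon v | u x v. length u = r \<and> x \<in> S \<and> length v = t}" (is "pm.span ?X = pm.span ?Y")
proof
  show "pm.span ?Y \<subseteq> pm.span ?X"
    by (rule pm.span_mono) (fastforce simp: mon_in_homog)
  show "pm.span ?X \<subseteq> pm.span ?Y"
  proof (rule pm.span_minimal)
    show "?X \<subseteq> pm.span ?Y"
    proof safe
      fix f x g :: "'v list \<Rightarrow>\<^sub>0 'k"
      assume f: "f \<in> homog r" and x: "x \<in> S" and g: "g \<in> homog t"
      have "mon u * x * g \<in> pm.span ?Y" if u: "length u = r" for u
      proof (rule span_image_subset[OF plinear_mult_left])
        show "g \<in> pm.span (mon ` {w. length w = t})" using g by (simp add: homog_eq_span)
        fix y :: "'v list \<Rightarrow>\<^sub>0 'k" assume "y \<in> mon ` {w. length w = t}"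
        then show "mon u * x * y \<in> pm.span ?Y"
          using u x by (intro pm.span_base) blast
      qed simp
      moreover have "plinear (\<lambda>f. f * x * g)"
        by (rule plinear_comp[OF plinear_mult_right plinear_mult_right])
      ultimately show "f * x * g \<in> pm.span ?Y"
        using f unfolding homog_eq_span[of r] by (rule_tac span_image_subset[of "\<lambda>f. f * x * g"]) auto
    qed
  qed simp
qed

text \<open>The image of an intersection may be smaller than the intersection of the images. Here
  they agree, because every member contains the kernel and membership does not depend on the
  representative.\<close>

lemma koszul_dual_space_eq:
  "koszul_dual_space scale N relations i = tclass ` free_dual scale N S i"
proof (cases "i < N")
  case True
  then show ?thesis
    by (simp add: koszul_dual_space_def free_dual_def T.q_grade T.image_span_kernel
        pm.span_eq_iff[THEN iffD2, OF subspace_homog])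
next
  case False
  let ?X = "\<lambda>r t. pm.span ({mon u * x * mon v | u x v. length u = r \<and> x \<in> S \<and> length v = t} \<union> lin_ideal scale)"
  have span: "span_in (tensor_algebra scale) {u \<otimes>\<^bsub>tensor_algebra scale\<^esub> \<rho> \<otimes>\<^bsub>tensor_algebra scale\<^esub> v | u \<rho> v.
      u \<in> tensor_power scale r \<and> \<rho> \<in> relations \<and> v \<in> tensor_power scale t} = tclass ` ?X r t" for r t
  proof -
    have "{u \<otimes>\<^bsub>tensor_algebra scale\<^esub> \<rho> \<otimes>\<^bsub>tensor_algebra scale\<^esub> v | u \<rho> v.
        u \<in> tensor_power scale r \<and> \<rho> \<in> relations \<and> v \<in> tensor_power scale t} =
      tclass ` {f * x * g | f x g. f \<in> homog r \<and> x \<in> S \<and> g \<in> homog t}"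
      (is "?L = ?R")
    proof
      show "?L \<subseteq> ?R"
        unfolding T.q_grade
      proof safe
        fix f x g :: "'v list \<Rightarrow>\<^sub>0 'k" assume "f \<in> homog r" "x \<in> S" "g \<in> homog t"
        then show "tclass f \<otimes>\<^bsub>tensor_algebra scale\<^esub> tclass x \<otimes>\<^bsub>tensor_algebra scale\<^esub> tclass g \<in> ?R"
          unfolding T.q_mult[symmetric] by blast
      qed
      show "?R \<subseteq> ?L"
      proof
        fix z assume "z \<in> ?R"
        then obtain f x g where "z = tclass (f * x * g)" and *: "f \<in> homog r" "x \<in> S" "g \<in> homog t"
          by blast
        then have "z = tclass f \<otimes>\<^bsub>tensor_algebra scale\<^esub> tclass x \<otimes>\<^bsub>tensor_algebra scale\<^esub> tclass g"
          by (simp only: T.q_mult)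
        then show "z \<in> ?L" unfolding T.q_grade using * by blast
      qed
    qed
    then show ?thesis
      by (simp add: T.span_in_image sandwich_homog_span T.image_span_kernel)
  qed
  have mem: "tclass x \<in> tclass ` ?X r t \<longleftrightarrow> x \<in> ?X r t" for x r t
    by (rule T.image_mem_iff) (auto intro: pm.span_superset[THEN subsetD])
  have "koszul_dual_space scale N relations i = (\<Inter>(r, t) \<in> {(r, t). r + t = i - N}. tclass ` ?X r t)"
    using False by (simp add: koszul_dual_space_def span)
  also have "\<dots> = tclass ` (\<Inter>(r, t) \<in> {(r, t). r + t = i - N}. ?X r t)"
  proof
    show "(\<Inter>(r, t) \<in> {(r, t). r + t = i - N}. tclass ` ?X r t) \<subseteq>
        tclass ` (\<Inter>(r, t) \<in> {(r, t). r + t = i - N}. ?X r t)"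
    proof
      fix z assume z: "z \<in> (\<Inter>(r, t) \<in> {(r, t). r + t = i - N}. tclass ` ?X r t)"
      \<comment> \<open>The index set is nonempty, which supplies a representative of
        \<open>z\<close>.\<close>
      have "(0, i - N) \<in> {(r, t). r + t = i - N}" by simp
      from INT_D[OF z this] have "z \<in> tclass ` ?X 0 (i - N)" unfolding prod.case .
      then obtain x where x: "z = tclass x" by blast
      then have "x \<in> (\<Inter>(r, t) \<in> {(r, t). r + t = i - N}. ?X r t)"
        using z mem by auto
      then show "z \<in> tclass ` (\<Inter>(r, t) \<in> {(r, t). r + t = i - N}. ?X r t)"
        using x by blast
    qed
  qed blast
  finally show ?thesis using False by (simp add: free_dual_def)
qed

lemma koszul_chains_eq: "koszul_chains scale N relations j = kclass ` free_chains scale N S j"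
proof -
  let ?i = "koszul_degree N j"
  have "{koszul_tensor scale relations a w | a w. a \<in> carrier (homogeneous_algebra scale relations) \<and>
        w \<in> koszul_dual_space scale N relations ?i} =
      kclass ` {tens f w | f w. w \<in> free_dual scale N S ?i}"
    (is "?L = ?R")
  proof
    show "?L \<subseteq> ?R"
      unfolding koszul_dual_space_eq H.carrier_eq
    proof safe
      fix f w assume "w \<in> free_dual scale N S ?i"
      then show "koszul_tensor scale relations (hclass f) (tclass w) \<in> ?R"
        unfolding HT.pure_tensor_eq by blast
    qed
    show "?R \<subseteq> ?L"
      unfolding koszul_dual_space_eq
    proof safe
      fix f w assume w: "w \<in> free_dual scale N S ?i"
      have "kclass (tens f w) = koszul_tensor scale relations (hclass f) (tclass w)"
        by (rule HT.pure_tensor_eq[symmetric])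
      then show "\<exists>a w'. kclass (tens f w) = koszul_tensor scale relations a w' \<and>
          a \<in> carrier (homogeneous_algebra scale relations) \<and> w' \<in> tclass ` free_dual scale N S ?i"
        using w H.q_in_carrier by blast
    qed
  qed
  then show ?thesis
    by (simp add: koszul_chains_def free_chains_def C.span_in_image C.image_span_kernel)
qed

lemma koszul_complex_acyclic_iff: "koszul_complex_acyclic scale N relations \<longleftrightarrow> free_acyclic scale N S"
proof -
  have mem: "kclass x \<in> kclass ` free_chains scale N S j \<longleftrightarrow> x \<in> free_chains scale N S j" for x j
    by (rule C.image_mem_iff) (auto simp: free_chains_def intro: pm.span_superset[THEN subsetD])
  have eq: "{x \<in> kclass ` free_chains scale N S j. koszul_differential scale N relations j x =
        \<zero>\<^bsub>koszul_ambient scale relations\<^esub>} =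
      koszul_differential scale N relations (Suc j) ` kclass ` free_chains scale N S (Suc j) \<longleftrightarrow>
    (\<forall>x. x \<in> free_chains scale N S j \<and> free_differential N j x \<in> koszul_kernel scale S \<longleftrightarrow>
     (\<exists>y\<in>free_chains scale N S (Suc j). x - free_differential N (Suc j) y \<in> koszul_kernel scale S))"
    (is "?A = ?B \<longleftrightarrow> ?R") if "j \<ge> 1" for j
  proof -
    \<comment> \<open>Both sides consist of classes, so their equality can be tested on
      representatives.\<close>
    have range_eq: "X = Y \<longleftrightarrow> (\<forall>x. kclass x \<in> X \<longleftrightarrow> kclass x \<in> Y)"
      if "X \<subseteq> range kclass" "Y \<subseteq> range kclass" for X Y
      using that by blast
    have "?A = ?B \<longleftrightarrow> (\<forall>x. kclass x \<in> ?A \<longleftrightarrow> kclass x \<in> ?B)"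
    proof (rule range_eq)
      show "?A \<subseteq> range kclass" by blast
      show "?B \<subseteq> range kclass"
        unfolding image_image koszul_differential_kclass by blast
    qed
    also have "\<dots> \<longleftrightarrow> ?R"
    proof -
      have "kclass x \<in> ?A \<longleftrightarrow> x \<in> free_chains scale N S j \<and> free_differential N j x \<in> koszul_kernel scale S" for x
        unfolding mem_Collect_eq mem koszul_differential_kclass C.q_eq_zero_iff ..
      moreover have "kclass x \<in> ?B \<longleftrightarrow>
          (\<exists>y\<in>free_chains scale N S (Suc j). x - free_differential N (Suc j) y \<in> koszul_kernel scale S)" for x
        unfolding image_image koszul_differential_kclass image_iff C.q_eq_iff ..
      ultimately show ?thesis by (simp only:)
    qed
    finally show ?thesis .
  qed
  show ?thesis
    unfolding koszul_complex_acyclic_def free_acyclic_def koszul_chains_eq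
    by (intro all_cong1 imp_cong refl) (rule eq)
qed

end


section \<open>Semi-cross products of presented algebras\<close>

lemma graded_algebra_isosI:
  assumes "algebra_presentation A p K" "algebra_presentation B q K" "\<And>x. h (p x) = q x"
  shows "h \<in> graded_algebra_isos A B"
proof -
  interpret A: algebra_presentation A p K by fact
  interpret B: algebra_presentation B q K by fact
  have "h \<in> ring_hom A B"
    by (rule ring_hom_memI) (auto simp: A.carrier_eq A.q_add[symmetric] A.q_mult[symmetric]
        A.q_one[symmetric] assms(3) B.q_add B.q_mult B.q_one)
  moreover have "bij_betw h (carrier A) (carrier B)"
    by (auto simp: bij_betw_def inj_on_def A.carrier_eq B.carrier_eq assms(3) A.q_eq_iff B.q_eq_iff
        image_image)
  moreover have "h \<in> linear_maps A B"
    by (auto simp: linear_maps_def A.carrier_eq A.q_add[symmetric] A.q_scale[symmetric] assms(3)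
        B.q_add B.q_scale)
  moreover have "h ` grade A n = grade B n" for n
    by (simp add: A.q_grade B.q_grade image_image assms(3))
  ultimately show ?thesis by (simp add: graded_algebra_isos_def ring_iso_def)
qed

lemma graded_algebra_isos_nonempty:
  assumes "algebra_presentation A p K" "algebra_presentation B q K"
  shows "graded_algebra_isos A B \<noteq> {}"
proof -
  interpret A: algebra_presentation A p K by fact
  interpret B: algebra_presentation B q K by fact
  have "q (SOME y. p y = p x) = q x" for x
  proof -
    have "p (SOME y. p y = p x) = p x" by (rule someI_ex) blast
    then show ?thesis by (simp only: A.q_eq_iff B.q_eq_iff)
  qed
  then have "(\<lambda>X. q (SOME y. p y = X)) \<in> graded_algebra_isos A B"
    by (intro graded_algebra_isosI[OF assms])
  then show ?thesis by blast
qed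

text \<open>Composing the presentation of A(E,R) with the isomorphism presents \<open>B\<close>
  itself with the same kernel. No isomorphism is left, and acyclicity is a condition on
  \<open>S\<close> alone.\<close>

lemma (in vector_space) koszul_algebra_iff:
  assumes "abelian_group B"
  shows "koszul_algebra scale N B \<longleftrightarrow> (\<exists>S q. relation_space scale N S \<and>
    algebra_presentation B q (relation_ideal scale S) \<and> free_acyclic scale N S)"
proof
  assume "koszul_algebra scale N B"
  then obtain R h where R: "linear_subspace R (tensor_algebra scale)" "R \<subseteq> tensor_power scale N"
    and h: "h \<in> graded_algebra_isos (homogeneous_algebra scale R) B"
    and ac: "koszul_complex_acyclic scale N R"
    unfolding koszul_algebra_def by blast
  obtain S where S: "relation_space scale N S" and RS: "R = tensor_class scale ` S"
    by (rule relation_space_of_subspace[OF R])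
  interpret koszul_presentation scale N S by unfold_locales (rule S)
  have "algebra_presentation B (\<lambda>x. h (hclass x)) (relation_ideal scale S)"
    using h unfolding RS by (rule isos_algebra_presentation[OF H.algebra_presentation_axioms _ assms])
  then show "\<exists>S q. relation_space scale N S \<and>
    algebra_presentation B q (relation_ideal scale S) \<and> free_acyclic scale N S"
    using S ac koszul_complex_acyclic_iff unfolding RS by blast
next
  assume "\<exists>S q. relation_space scale N S \<and>
    algebra_presentation B q (relation_ideal scale S) \<and> free_acyclic scale N S"
  then obtain S q where S: "relation_space scale N S"
    and q: "algebra_presentation B q (relation_ideal scale S)" and ac: "free_acyclic scale N S"
    by blast
  interpret koszul_presentation scale N S by unfold_locales (rule S)
  show "koszul_algebra scale N B"
    unfolding koszul_algebra_def
    using subspace_of_relation_space[OF S] koszul_complex_acyclic_iff ac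
      graded_algebra_isos_nonempty[OF H.algebra_presentation_axioms q] by blast
qed

section \<open>Homogeneous components and products in presented algebras\<close>

context algebra_presentation
begin

text \<open>A component may be nonzero on words and yet have class 0; the lemma compares sums over
  the two supports.\<close>

lemma sum_kernel_neutral:
  assumes "finite Y" "X \<subseteq> Y" "\<And>n. n \<in> Y - X \<Longrightarrow> f n \<in> K"
  shows "q (\<Sum>n\<in>X. f n) = q (\<Sum>n\<in>Y. f n)"
proof -
  have "(\<Sum>n\<in>Y. f n) - (\<Sum>n\<in>X. f n) = (\<Sum>n\<in>Y - X. f n)"
    using sum.subset_diff[OF assms(2,1), of f] by simp
  moreover have "(\<Sum>n\<in>Y - X. f n) \<in> K"
    by (rule pm.subspace_sum[OF subspace_kernel]) (rule assms(3))
  ultimately have "q (\<Sum>n\<in>Y. f n) = q (\<Sum>n\<in>X. f n)" by (simp only: q_eq_iff)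
  then show ?thesis by (rule sym)
qed

text \<open>A graded kernel makes the decomposition into components unique, so the chosen one
  consists of the classes of the components on words.\<close>

lemma homogeneous_component_q:
  assumes graded: "\<And>n x. x \<in> K \<Longrightarrow> pr n x \<in> K"
  shows "homogeneous_component V (q f) n = q (pr n f)"
proof -
  define P where "P c \<longleftrightarrow> (\<forall>n. c n \<in> grade V n) \<and> finite {n. c n \<noteq> \<zero>\<^bsub>V\<^esub>} \<and>
     q f = (\<Oplus>\<^bsub>V\<^esub>n\<in>{n. c n \<noteq> \<zero>\<^bsub>V\<^esub>}. c n)" for c
  have "P (\<lambda>n. q (pr n f))"
    unfolding P_def
  proof (intro conjI allI)
    have sub: "{n. q (pr n f) \<noteq> \<zero>\<^bsub>V\<^esub>} \<subseteq> {n. pr n f \<noteq> 0}" using q_zero by auto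
    show fin: "finite {n. q (pr n f) \<noteq> \<zero>\<^bsub>V\<^esub>}" by (rule finite_subset[OF sub finite_pr_support])
    show "q (pr n f) \<in> grade V n" for n unfolding q_grade by (intro imageI pr_in_homog)
    have "q (\<Sum>n\<in>{n. q (pr n f) \<noteq> \<zero>\<^bsub>V\<^esub>}. pr n f) = q (\<Sum>n\<in>{n. pr n f \<noteq> 0}. pr n f)"
      by (rule sum_kernel_neutral[OF finite_pr_support sub]) (simp add: q_eq_zero_iff[symmetric])
    then show "q f = (\<Oplus>\<^bsub>V\<^esub>n\<in>{n. q (pr n f) \<noteq> \<zero>\<^bsub>V\<^esub>}. q (pr n f))"
      by (simp add: finsum_q[OF fin] sum_pr[OF finite_pr_support order.refl])
  qed
  moreover have "homogeneous_component V (q f) = (SOME c. P c)"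
    unfolding homogeneous_component_def P_def ..
  ultimately have P: "P (homogeneous_component V (q f))"
    by (simp only: someI[of P])
  define c where "c = homogeneous_component V (q f)"
  define A where "A = {n. c n \<noteq> \<zero>\<^bsub>V\<^esub>}"
  have "\<forall>n. \<exists>x. x \<in> homog n \<and> c n = q x"
    using P unfolding P_def c_def q_grade by blast
  \<comment> \<open>Homogeneous representatives of the chosen components; projection to degree
    \<open>n\<close> stays in the kernel and isolates \<open>d n\<close>.\<close>
  then obtain d where d: "\<And>n. d n \<in> homog n" "\<And>n. c n = q (d n)" by metis
  have fin: "finite A" using P unfolding P_def c_def A_def by blast
  have "q f = (\<Oplus>\<^bsub>V\<^esub>n\<in>A. c n)" using P unfolding P_def c_def A_def by blast
  then have "q f = q (\<Sum>n\<in>A. d n)" unfolding d(2) finsum_q[OF fin] .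
  then have "pr n (f - (\<Sum>n\<in>A. d n)) \<in> K" by (intro graded) (simp only: q_eq_iff)
  then have "pr n f - pr n (\<Sum>n\<in>A. d n) \<in> K" by (simp only: plinearD(4)[OF plinear_pr])
  then have eq: "q (pr n f) = q (pr n (\<Sum>n\<in>A. d n))" by (simp only: q_eq_iff)
  have "pr n (\<Sum>m\<in>A. d m) = (\<Sum>m\<in>A. pr n (d m))"
    using fin by (induction A) (simp_all add: plinearD[OF plinear_pr])
  also have "\<dots> = (\<Sum>m\<in>A. if m = n then d n else 0)"
    by (rule sum.cong) (auto simp: pr_homog[OF d(1)])
  also have "\<dots> = (if n \<in> A then d n else 0)" using fin by simp
  finally have "q (pr n f) = c n"
    using eq by (simp add: d(2)[symmetric] A_def q_zero split: if_splits)
  then show ?thesis by (simp add: c_def)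
qed

text \<open>Used to recognise the map induced by the inverse of \<alpha> as a graded automorphism of
  the semi-cross product.\<close>

lemma presentation_lmap:
  assumes "\<And>x. b (a x) = x" "\<And>x. a (b x) = x" and K: "\<And>p. lmap b p \<in> K \<longleftrightarrow> p \<in> K"
  shows "algebra_presentation V (\<lambda>x. q (lmap b x)) K"
proof
  have inv: "lmap b (lmap a p) = p" for p :: "'v list \<Rightarrow>\<^sub>0 'k"
    by (simp add: lmap_lmap assms lmap_ident)
  have "q x \<in> range (\<lambda>x. q (lmap b x))" for x
    using inv[of x] by (metis rangeI)
  then show "carrier V = range (\<lambda>x. q (lmap b x))" by (auto simp: carrier_eq)
  have "q x \<in> (\<lambda>x. q (lmap b x)) ` homog n" if "x \<in> homog n" for x n
    using inv[of x] lmap_homog[OF that, of a] by (metis imageI)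
  then show "grade V n = (\<lambda>x. q (lmap b x)) ` homog n" for n
    by (auto simp: q_grade intro: lmap_homog)
  show "q (lmap b x) = q (lmap b y) \<longleftrightarrow> x - y \<in> K" for x y
    by (simp add: q_eq_iff lmap_linear(4)[symmetric] K)
qed (simp_all add: lmap_linear lmap_mult q_add q_scale q_zero q_mult q_one)

end

text \<open>The sum runs over the degrees of \<open>twist a f\<close>, which is the form in which
  the semi-cross product of classes is computed.\<close>

lemma twist_mult_sum:
  "twist a (f * g) = (\<Sum>n\<in>{n. pr n (twist a f) \<noteq> 0}. pr n (twist a f) * lmap (a ^^ n) (twist a g))"
proof -
  let ?X = "{n. pr n f \<noteq> 0}"
  have pr: "pr n (twist a f) = twist a (pr n f)" for n
    unfolding twist_def by (rule pr_kmap) simp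
  have "f * g = (\<Sum>n\<in>?X. pr n f * g)"
    by (simp add: sum_distrib_right[symmetric] sum_pr[OF finite_pr_support order.refl])
  moreover have "twist a (\<Sum>n\<in>?X. pr n f * g) = (\<Sum>n\<in>?X. twist a (pr n f * g))"
    using finite_pr_support by (induction rule: finite_induct) (simp_all add: twist_linear)
  ultimately have "twist a (f * g) = (\<Sum>n\<in>?X. pr n (twist a f) * lmap (a ^^ n) (twist a g))"
    by (simp add: twist_mult_homog[OF pr_in_homog] pr)
  also have "\<dots> = (\<Sum>n\<in>{n. pr n (twist a f) \<noteq> 0}. pr n (twist a f) * lmap (a ^^ n) (twist a g))"
    by (rule sum.mono_neutral_right) (auto simp: finite_pr_support pr twist_linear)
  finally show ?thesis .
qed

text \<open>By \<open>twist_mult_sum\<close> the semi-cross product of classes of twists is the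
  class of the twist of a plain product. Surjectivity comes from the inverse twist.\<close>

lemma algebra_presentation_semi_cross_product:
  fixes V :: "('k::field, 'a) graded_algebra" and q :: "('v list \<Rightarrow>\<^sub>0 'k) \<Rightarrow> 'a"
  assumes V: "algebra_presentation V q K" and graded: "\<And>n x. x \<in> K \<Longrightarrow> pr n x \<in> K"
    and inv: "\<And>x. b (a x) = x" "\<And>x. a (b x) = x"
    and \<alpha>: "\<And>x. \<alpha> (q x) = q (lmap a x)"
  shows "algebra_presentation (semi_cross_product V \<alpha>) (\<lambda>x. q (twist a x)) {x. twist a x \<in> K}"
proof -
  interpret algebra_presentation V q K by fact
  let ?C = "semi_cross_product V \<alpha>"
  have fields: "carrier ?C = carrier V" "add ?C = add V" "\<zero>\<^bsub>?C\<^esub> = \<zero>\<^bsub>V\<^esub>" "\<one>\<^bsub>?C\<^esub> = \<one>\<^bsub>V\<^esub>"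
    "smult ?C = smult V" "grade ?C = grade V"
    by (simp_all add: semi_cross_product_def)
  have \<alpha>n: "(\<alpha> ^^ n) (q x) = q (lmap (a ^^ n) x)" for n x
    unfolding lmap_funpow[symmetric] by (induction n) (simp_all add: \<alpha>)
  have mult: "q f \<otimes>\<^bsub>?C\<^esub> q g = q (\<Sum>n\<in>{n. pr n f \<noteq> 0}. pr n f * lmap (a ^^ n) g)" for f g
  proof -
    let ?X = "{n. q (pr n f) \<noteq> \<zero>\<^bsub>V\<^esub>}"
    have sub: "?X \<subseteq> {n. pr n f \<noteq> 0}" using q_zero by auto
    have fin: "finite ?X" by (rule finite_subset[OF sub finite_pr_support])
    have "q f \<otimes>\<^bsub>?C\<^esub> q g = (\<Oplus>\<^bsub>V\<^esub>n\<in>?X. q (pr n f * lmap (a ^^ n) g))"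
      by (simp add: semi_cross_product_def homogeneous_component_q[OF graded] \<alpha>n q_mult)
    also have "\<dots> = q (\<Sum>n\<in>?X. pr n f * lmap (a ^^ n) g)" by (rule finsum_q[OF fin])
    also have "\<dots> = q (\<Sum>n\<in>{n. pr n f \<noteq> 0}. pr n f * lmap (a ^^ n) g)"
      by (rule sum_kernel_neutral[OF finite_pr_support sub])
        (auto simp: q_eq_zero_iff intro: kernel_mult)
    finally show ?thesis .
  qed
  have inv': "twist a (twist b x) = x" for x :: "'v list \<Rightarrow>\<^sub>0 'k"
    by (rule twist_twist[OF inv(2,1)])
  show ?thesis
  proof
    have "q x \<in> range (\<lambda>x. q (twist a x))" for x
      using inv'[of x] by (metis rangeI)
    then show "carrier ?C = range (\<lambda>x. q (twist a x))" by (auto simp: fields carrier_eq)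
    have "q x \<in> (\<lambda>x. q (twist a x)) ` homog n" if "x \<in> homog n" for x n
      using inv'[of x] twist_homog[OF that, of b] by (metis imageI)
    then show "grade ?C n = (\<lambda>x. q (twist a x)) ` homog n" for n
      by (auto simp: fields q_grade intro: twist_homog)
    show "q (twist a (x * y)) = q (twist a x) \<otimes>\<^bsub>?C\<^esub> q (twist a y)" for x y
      unfolding mult twist_mult_sum[of a x y] ..
    have "twist a (1 :: 'v list \<Rightarrow>\<^sub>0 'k) = 1" by (simp add: one_eq_mon)
    then show "q (twist a 1) = \<one>\<^bsub>?C\<^esub>" by (simp add: fields q_one)
  qed (simp_all add: fields twist_linear q_add q_scale q_zero q_eq_iff)
qed


section \<open>Automorphisms act on generators\<close>

text \<open>Evaluation of the degree-one part in E; a left inverse to the inclusion of letters, used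
  to show that E embeds in A.\<close>

definition linear_part :: "('k::field \<Rightarrow> 'v::ab_group_add \<Rightarrow> 'v) \<Rightarrow> ('v list \<Rightarrow>\<^sub>0 'k) \<Rightarrow> 'v" where
  "linear_part s = pext s (\<lambda>w. if length w = 1 then hd w else 0)"

context vector_space
begin

text \<open>Sandwiches of homogeneous generators are homogeneous, so the ideal is graded. In degree
  \<open>N\<close> a nonzero sandwich of an element of \<open>S\<close> has no room for outer words,
  and those of linear relations lie in \<open>S\<close> by \<open>relation_space\<close>.\<close>

lemma relation_ideal_homog_part:
  assumes "relation_space scale N S" "p \<in> relation_ideal scale S"
  shows "pr n p \<in> relation_ideal scale S" "pr N p \<in> S"
proof -
  have S: "pm.subspace S" "S \<subseteq> homog N" "lin_ideal scale \<inter> homog N \<subseteq> S"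
    using assms(1) by (auto simp: relation_space_def)
  have p: "p \<in> pm.span (sandwich (S \<union> linear_relations scale))"
    using assms(2) by (simp add: relation_ideal_def)
  have gen: "(\<exists>m. y \<in> homog m) \<and> (y \<in> homog N \<longrightarrow> y \<in> S)" if y_in: "y \<in> sandwich (S \<union> linear_relations scale)" for y
  proof -
    obtain u z v where y: "y = mon u * z * mon v" "z \<in> S \<union> linear_relations scale"
      using y_in unfolding sandwich_def by blast
    obtain m where m: "z \<in> homog m" using y(2) S(2) lin_rel_homog by blast
    have hy: "y \<in> homog (length u + m + length v)"
      unfolding y(1) using m by (intro homog_mult) (auto simp: mon_in_homog)
    have "y \<in> S" if yN: "y \<in> homog N"
      using y(2)
    proof
      assume z: "z \<in> S"
      show ?thesis
      \<comment> \<open>0 is homogeneous of every degree, so degrees can be compared for nonzero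
        elements only.\<close>
      proof (cases "y = 0")
        case False
        have "z \<noteq> 0" using False y(1) by auto
        moreover have "z \<in> homog N" using z S(2) by blast
        ultimately have "m = N" using m pr_homog[of z N m] pr_homog[of z m m] by (auto split: if_splits)
        moreover have "length u + m + length v = N"
          using hy yN False pr_homog[of y N "length u + m + length v"]
            pr_homog[of y "length u + m + length v" "length u + m + length v"] by (auto split: if_splits)
        ultimately have "u = []" "v = []" by auto
        then show ?thesis using z y(1) by (simp add: one_eq_mon[symmetric])
      qed (use S(1) pm.subspace_0 in auto)
    next
      assume "z \<in> linear_relations scale"
      then have "y \<in> lin_ideal scale"
        unfolding y(1) by (intro pm.span_base) (auto simp: sandwich_def)
      then show ?thesis using yN S(3) by blast
    qed
    then show ?thesis using hy by blast
  qed
  show "pr n p \<in> relation_ideal scale S"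
  proof (rule span_image_subset[OF plinear_pr _ _ p])
    fix y assume y: "y \<in> sandwich (S \<union> linear_relations scale)"
    then obtain m where "y \<in> homog m" using gen by blast
    then have "pr n y = y \<or> pr n y = 0" by (simp add: pr_homog)
    moreover have "y \<in> relation_ideal scale S"
      unfolding relation_ideal_def using y by (rule pm.span_base)
    ultimately show "pr n y \<in> relation_ideal scale S"
      by (auto simp: relation_ideal_def pm.span_zero)
  qed (simp add: relation_ideal_def)
  show "pr N p \<in> S"
  proof (rule span_image_subset[OF plinear_pr S(1) _ p])
    fix y assume y: "y \<in> sandwich (S \<union> linear_relations scale)"
    then obtain m where m: "y \<in> homog m" using gen by blast
    show "pr N y \<in> S"
      using gen[OF y] m pm.subspace_0[OF S(1)] by (cases "m = N") (auto simp: pr_homog[OF m])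
  qed
qed

lemma relation_space_subset_ideal: "S \<subseteq> relation_ideal scale S"
  unfolding relation_ideal_def
  using sandwich_superset[of "S \<union> linear_relations scale"] pm.span_superset by blast

lemma relation_ideal_inter_homog:
  assumes "relation_space scale N S" "p \<in> relation_ideal scale S" "p \<in> homog N"
  shows "p \<in> S"
  using relation_ideal_homog_part(2)[OF assms(1,2)] pr_homog[OF assms(3), of N] by simp

lemma linear_part_single:
  "linear_part scale (Poly_Mapping.single w c) = scale c (if length w = 1 then hd w else 0)"
  by (simp add: linear_part_def)

lemma linear_linear_part: "Vector_Spaces.linear pscale scale (linear_part scale)"
  unfolding linear_part_def by (rule linear_pext)

lemma linear_part_homog:
  assumes "p \<in> homog n" "n \<noteq> 1"
  shows "linear_part scale p = 0"
  unfolding linear_part_def pext_def using assms by (intro sum.neutral) (auto simp: homog_def)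

text \<open>Here N \<ge> 2 enters: elements of \<open>S\<close> and sandwiches of linear relations
  with a nonempty outer word have degree at least 2. In degree one only the linear relations remain,
  and these vanish in E.\<close>

lemma linear_part_relation_ideal:
  assumes "relation_space scale N S" "N \<ge> 2" "p \<in> relation_ideal scale S"
  shows "linear_part scale p = 0"
proof -
  interpret l: Vector_Spaces.linear pscale scale "linear_part scale" by (rule linear_linear_part)
  have "p \<in> pm.span (sandwich (S \<union> linear_relations scale))"
    using assms(3) by (simp add: relation_ideal_def)
  then show ?thesis
  proof (rule l.eq_0_on_span[rotated])
    fix y assume "y \<in> sandwich (S \<union> linear_relations scale)"
    then obtain u z v where y: "y = mon u * z * mon v" "z \<in> S \<union> linear_relations scale"
      by (auto simp: sandwich_def)
    have homog: "y \<in> homog (length u + m + length v)" if "z \<in> homog m" for m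
      unfolding y(1) using that by (intro homog_mult) (auto simp: mon_in_homog)
    from y(2) show "linear_part scale y = 0"
    proof
      assume "z \<in> S"
      then have "z \<in> homog N" using assms(1) by (auto simp: relation_space_def)
      then show ?thesis using linear_part_homog[OF homog] assms(2) by auto
    next
      assume z: "z \<in> linear_relations scale"
      show ?thesis
      proof (cases "u = [] \<and> v = []")
        case True
        then have "y = z" using y(1) by (simp add: one_eq_mon[symmetric])
        moreover have "linear_part scale (Poly_Mapping.single [x] c) = scale c x" for x c
          by (simp add: linear_part_def)
        ultimately show ?thesis
          using z unfolding linear_relations_def by (auto simp: l.diff)
      next
        case False
        then show ?thesis using linear_part_homog[OF homog[OF lin_rel_homog[OF z]]] by auto
      qed
    qed
  qed
qed

lemma sub_linear_part_mem:
  assumes "p \<in> homog 1"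
  shows "p - mon [linear_part scale p] \<in> lin_ideal scale"
proof -
  interpret l: Vector_Spaces.linear pscale scale "linear_part scale" by (rule linear_linear_part)
  let ?U = "{p. p - mon [linear_part scale p] \<in> lin_ideal scale}"
  have "linear_relations scale \<subseteq> lin_ideal scale"
    using sandwich_superset pm.span_superset by blast
  then have add: "mon [x + y] - mon [x] - mon [y] \<in> lin_ideal scale"
    and sc: "mon [scale c x] - Poly_Mapping.single [x] c \<in> lin_ideal scale" for x y c
    unfolding linear_relations_def by blast+
  have "pm.subspace ?U"
    unfolding pm.subspace_def
  proof (intro conjI ballI allI)
    show "0 \<in> ?U"
      using pm.span_neg[OF sc[of 0 0]] by (simp add: l.zero)
  next
    fix x y assume "x \<in> ?U" "y \<in> ?U"
    then have "x - mon [linear_part scale x] \<in> lin_ideal scale" "y - mon [linear_part scale y] \<in> lin_ideal scale"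
      by simp_all
    from pm.span_diff[OF pm.span_add[OF this] add[of "linear_part scale x" "linear_part scale y"]]
    show "x + y \<in> ?U" by (simp add: l.add)
  next
    fix c x assume "x \<in> ?U"
    then have "x - mon [linear_part scale x] \<in> lin_ideal scale" by simp
    from pm.span_diff[OF pm.span_scale[OF this, of c] sc[of c "linear_part scale x"]]
    show "pscale c x \<in> ?U" by (simp add: l.scale pm.scale_right_diff_distrib)
  qed
  moreover have "mon w \<in> ?U" if "length w = 1" for w
    using that by (auto simp: length_Suc_conv linear_part_single pm.span_zero)
  ultimately have "homog 1 \<subseteq> ?U"
    unfolding homog_eq_span by (intro pm.span_minimal) auto
  then show ?thesis using assms by blast
qed

text \<open>A graded automorphism preserves degree one, where classes correspond to vectors of E:
  existence by \<open>sub_linear_part_mem\<close>, uniqueness by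
  \<open>linear_part_relation_ideal\<close>. This defines \<open>a\<close>, and multiplicativity
  determines \<alpha> on words.\<close>

lemma automorphism_generators:
  assumes S: "relation_space scale N S" and N: "N \<ge> 2"
    and B: "algebra_presentation B q (relation_ideal scale S)"
    and \<alpha>: "\<alpha> \<in> graded_algebra_isos B B"
  obtains a b where "Vector_Spaces.linear scale scale a" "Vector_Spaces.linear scale scale b"
    "\<And>x. b (a x) = x" "\<And>x. a (b x) = x" "\<And>p. \<alpha> (q p) = q (lmap a p)"
    "\<And>p. lmap a p \<in> relation_ideal scale S \<longleftrightarrow> p \<in> relation_ideal scale S"
proof -
  interpret algebra_presentation B q "relation_ideal scale S" by fact
  interpret l: Vector_Spaces.linear pscale scale "linear_part scale" by (rule linear_linear_part)
  interpret \<alpha>q: algebra_presentation B "\<lambda>x. \<alpha> (q x)" "relation_ideal scale S"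
    by (rule isos_algebra_presentation[OF B \<alpha> abelian_group])
  have q_linear_part: "q p = q (mon [linear_part scale p])" if "p \<in> homog 1" for p
    unfolding q_eq_iff using sub_linear_part_mem[OF that]
    by (rule subsetD[OF lin_ideal_subset_relation_ideal])
  have q_inj: "x = y" if "q (mon [x]) = q (mon [y])" for x y
  proof -
    have "linear_part scale (mon [x] - mon [y]) = 0"
      using that by (intro linear_part_relation_ideal[OF S N]) (simp only: q_eq_iff)
    then show ?thesis by (simp add: l.diff linear_part_single)
  qed
  have range1: "\<exists>y. q p = q (mon [y])" if "q p \<in> grade B 1" for p
    using that q_linear_part unfolding q_grade by (metis imageE)
  have "\<exists>y. \<alpha> (q (mon [x])) = q (mon [y])" for x
  proof -
    have "\<alpha> (q (mon [x])) \<in> grade B 1"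
      unfolding \<alpha>q.q_grade by (intro imageI) (simp add: mon_in_homog)
    moreover obtain p where "\<alpha> (q (mon [x])) = q p"
      using \<alpha>q.q_in_carrier unfolding carrier_eq by blast
    ultimately show ?thesis using range1 by metis
  qed
  then obtain a where a: "\<And>x. \<alpha> (q (mon [x])) = q (mon [a x])" by metis
  have "\<exists>x. a x = y" for y
  proof -
    have "q (mon [y]) \<in> grade B 1"
      unfolding q_grade by (intro imageI) (simp add: mon_in_homog)
    then obtain p where p: "p \<in> homog 1" "q (mon [y]) = \<alpha> (q p)"
      unfolding \<alpha>q.q_grade by blast
    then have "q (mon [y]) = q (mon [a (linear_part scale p)])"
      using q_linear_part[OF p(1)] a by simp
    then show ?thesis using q_inj by metis
  qed
  \<comment> \<open>A right inverse, by surjectivity of \<open>a\<close>; injectivity then makes it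
    two-sided and linear.\<close>
  then obtain b where ab: "\<And>x. a (b x) = x" by metis
  have a_inj: "x = y" if "a x = a y" for x y
  proof -
    have "\<alpha> (q (mon [x])) = \<alpha> (q (mon [y]))" using that a by simp
    then have "q (mon [x]) = q (mon [y])" by (simp only: q_eq_iff \<alpha>q.q_eq_iff)
    then show ?thesis by (rule q_inj)
  qed
  then have ba: "b (a x) = x" for x using ab by blast
  have q_plus: "q (mon [x]) \<oplus>\<^bsub>B\<^esub> q (mon [y]) = q (mon [x + y])"
    and q_smult: "c \<odot>\<^bsub>B\<^esub> q (mon [x]) = q (mon [scale c x])" for x y c
    using q_linear_part[of "mon [x] + mon [y]"] q_linear_part[of "pscale c (mon [x])"]
      pm.subspace_add[OF subspace_homog, of "mon [x]" 1 "mon [y]"]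
      pm.subspace_scale[OF subspace_homog, of "mon [x]" 1 c]
    by (simp_all add: mon_in_homog l.add l.scale linear_part_single q_add[symmetric] q_scale[symmetric])
  have \<alpha>_add: "\<alpha> (q x \<oplus>\<^bsub>B\<^esub> q y) = \<alpha> (q x) \<oplus>\<^bsub>B\<^esub> \<alpha> (q y)"
    and \<alpha>_smult: "\<alpha> (c \<odot>\<^bsub>B\<^esub> q x) = c \<odot>\<^bsub>B\<^esub> \<alpha> (q x)"
    and \<alpha>_mult: "\<alpha> (q x \<otimes>\<^bsub>B\<^esub> q y) = \<alpha> (q x) \<otimes>\<^bsub>B\<^esub> \<alpha> (q y)" for x y c
    by (simp_all only: q_add[symmetric] \<alpha>q.q_add q_scale[symmetric] \<alpha>q.q_scale q_mult[symmetric] \<alpha>q.q_mult)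
  have a_add: "a (x + y) = a x + a y" for x y
    by (rule q_inj) (simp only: a[symmetric] q_plus[symmetric] \<alpha>_add)
  have a_scale: "a (scale c x) = scale c (a x)" for c x
    by (rule q_inj) (simp only: a[symmetric] q_smult[symmetric] \<alpha>_smult)
  have linear_a: "Vector_Spaces.linear scale scale a"
    by (simp add: Vector_Spaces.linear_iff vector_space_axioms a_add a_scale)
  have b_add: "b (x + y) = b x + b y" for x y
    by (rule a_inj) (simp add: ab a_add)
  have b_scale: "b (scale c x) = scale c (b x)" for c x
    by (rule a_inj) (simp add: ab a_scale)
  have linear_b: "Vector_Spaces.linear scale scale b"
    by (simp add: Vector_Spaces.linear_iff vector_space_axioms b_add b_scale)
  have words: "\<alpha> (q (mon w)) = q (mon (map a w))" for w
  proof (induction w)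
    case Nil
    show ?case using trans[OF \<alpha>q.q_one q_one[symmetric]] by (simp add: one_eq_mon)
  next
    case (Cons x w)
    have "mon (x # w) = mon [x] * (mon w :: 'b list \<Rightarrow>\<^sub>0 'a)"
      "mon (map a (x # w)) = mon [a x] * (mon (map a w) :: 'b list \<Rightarrow>\<^sub>0 'a)"
      by (simp_all add: mult_single plus_list_def)
    then show ?case by (simp only: q_mult \<alpha>_mult a Cons.IH)
  qed
  have \<alpha>_lmap: "\<alpha> (q p) = q (lmap a p)" for p
  proof (induction p rule: poly_mapping_additive_induct)
    case 1
    show ?case using trans[OF \<alpha>q.q_zero q_zero[symmetric]] by (simp only: lmap_linear(3))
  next
    case (2 x y)
    then show ?case by (simp only: q_add \<alpha>_add lmap_linear)
  next
    case (3 w c)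
    show ?case
      unfolding single_eq_pscale_mon[of w c] lmap_linear q_scale \<alpha>_smult words by simp
  qed
  \<comment> \<open>\<alpha> is bijective, so \<open>q\<close> and \<alpha> after \<open>q\<close>
    have the same kernel; this is \<alpha>(R) = R in terms of ideals.\<close>
  have "lmap a p \<in> relation_ideal scale S \<longleftrightarrow> p \<in> relation_ideal scale S" for p
    using q_eq_zero_iff[of "lmap a p"] \<alpha>q.q_eq_zero_iff[of p] \<alpha>_lmap[of p] by simp
  then show thesis
    by (rule that[OF linear_a linear_b ba ab \<alpha>_lmap])
qed

text \<open>Works from an arbitrary presentation of \<open>B\<close> and exports the data that are
  used again to invert the construction.\<close>

lemma koszul_semi_cross_product:
  fixes B :: "('a, 'c) graded_algebra"
  assumes S: "relation_space scale N S" and N: "N \<ge> 2"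
    and B: "algebra_presentation B q (relation_ideal scale S)"
    and \<alpha>: "\<alpha> \<in> graded_algebra_isos B B"
  obtains S' a b where "relation_space scale N S'"
    "algebra_presentation (semi_cross_product B \<alpha>) (\<lambda>x. q (twist a x)) (relation_ideal scale S')"
    "\<And>x. b (a x) = x" "\<And>x. a (b x) = x" "\<And>p. \<alpha> (q p) = q (lmap a p)"
    "\<And>p. lmap b p \<in> relation_ideal scale S' \<longleftrightarrow> p \<in> relation_ideal scale S'"
    "relation_ideal scale S' = {x. twist a x \<in> relation_ideal scale S}"
    "free_acyclic scale N S \<Longrightarrow> free_acyclic scale N S'"
proof -
  obtain a b where lin: "Vector_Spaces.linear scale scale a" "Vector_Spaces.linear scale scale b"
    and ba: "\<And>x. b (a x) = x" and ab: "\<And>x. a (b x) = x" and \<alpha>q: "\<And>p. \<alpha> (q p) = q (lmap a p)"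
    and K: "\<And>p. lmap a p \<in> relation_ideal scale S \<longleftrightarrow> p \<in> relation_ideal scale S"
    by (rule automorphism_generators[OF S N B \<alpha>]) (rule that; (assumption | blast))
  have S_simps: "pm.subspace S" "S \<subseteq> homog N" "lin_ideal scale \<inter> homog N \<subseteq> S"
    using S by (auto simp: relation_space_def)
  have ll: "lmap a (lmap b p) = p" "lmap b (lmap a p) = p" for p :: "'b list \<Rightarrow>\<^sub>0 'a"
    by (simp_all add: lmap_lmap ab ba lmap_ident)
  have tt: "twist a (twist b p) = p" for p :: "'b list \<Rightarrow>\<^sub>0 'a"
    by (rule twist_twist[OF ab ba])
  have comm: "twist a (lmap b p) = lmap b (twist a p)" for p :: "'b list \<Rightarrow>\<^sub>0 'a"
    using ll(2)[of "twist a (lmap b p)"] by (simp add: lmap_twist_commute ll)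
  \<comment> \<open>\<open>S\<close> is the degree-N part of its ideal, so stability of the ideal
    under \<open>a\<close> and \<open>b\<close> descends to \<open>S\<close>.\<close>
  have aS: "lmap a p \<in> S" if "p \<in> S" for p
    using that S_simps(2) relation_space_subset_ideal
    by (intro relation_ideal_inter_homog[OF S]) (auto simp: K lmap_homog)
  have bS: "lmap b p \<in> S" if "p \<in> S" for p
  proof (rule relation_ideal_inter_homog[OF S])
    show "lmap b p \<in> relation_ideal scale S"
      using K[of "lmap b p"] that relation_space_subset_ideal by (auto simp: ll)
    show "lmap b p \<in> homog N" using that S_simps(2) by (auto simp: lmap_homog)
  qed
  \<comment> \<open>The preimage of R under \<theta>_N, on representatives.\<close>
  define S' where "S' = {p. twist a p \<in> S} \<inter> homog N"
  have S': "relation_space scale N S'"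
    unfolding relation_space_def S'_def
  proof (intro conjI subsetI)
    show "pm.subspace ({p. twist a p \<in> S} \<inter> homog N)"
      by (intro pm.subspace_inter subspace_vimage plinear_twist S_simps subspace_homog)
    fix p assume "p \<in> lin_ideal scale \<inter> homog N"
    then show "p \<in> {p. twist a p \<in> S} \<inter> homog N"
      using twist_lin_ideal[OF lin(1)] twist_homog S_simps(3) by blast
  qed simp
  \<comment> \<open>\<open>a\<close> leads from \<open>S'\<close> to \<open>S\<close> and
    \<open>b\<close> leads back; together they give the equality of ideals and the transfer of
    acyclicity.\<close>
  interpret A: koszul_transfer scale N S' S a
    by (intro koszul_transfer.intro vector_space_axioms koszul_transfer_axioms.intro lin(1))
      (use aS in \<open>auto simp: S'_def\<close>)
  interpret A': koszul_transfer scale N S S' b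
    by (intro koszul_transfer.intro vector_space_axioms koszul_transfer_axioms.intro lin(2))
      (use S_simps(2) bS in \<open>auto simp: S'_def tt comm intro: twist_homog lmap_homog\<close>)
  have ideal: "relation_ideal scale S' = {x. twist a x \<in> relation_ideal scale S}"
  proof safe
    fix x assume "twist a x \<in> relation_ideal scale S"
    then have "twist b (twist a x) \<in> relation_ideal scale S'" by (rule A'.twist_relation_ideal)
    then show "x \<in> relation_ideal scale S'" by (simp add: twist_twist[OF ba ab])
  qed (rule A.twist_relation_ideal)
  have K': "lmap b p \<in> relation_ideal scale S' \<longleftrightarrow> p \<in> relation_ideal scale S'" for p
    using K[of "lmap b (twist a p)"] by (simp add: ideal comm ll)
  have pres: "algebra_presentation (semi_cross_product B \<alpha>) (\<lambda>x. q (twist a x)) (relation_ideal scale S')"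
    unfolding ideal
    by (rule algebra_presentation_semi_cross_product[where b = b, OF B _ ba ab \<alpha>q])
      (rule relation_ideal_homog_part(1)[OF S])
  have ac: "free_acyclic scale N S'" if "free_acyclic scale N S"
    by (rule free_acyclic_transfer[OF A.koszul_transfer_axioms A'.koszul_transfer_axioms ba ab that])
  show thesis
    by (rule that[OF S' pres ba ab \<alpha>q K' ideal ac])
qed

text \<open>The presentation witnessing Koszulness of \<open>B\<close> is taken as it comes and its
  own \<open>S'\<close> is built. With no fixed R involved, the lemma applies to A^\<alpha> in
  turn.\<close>

lemma koszul_algebra_semi_cross_productI:
  fixes B :: "('a, 'c) graded_algebra"
  assumes N: "N \<ge> 2" and B: "abelian_group B" "koszul_algebra scale N B"
    and \<alpha>: "\<alpha> \<in> graded_algebra_isos B B"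
  shows "koszul_algebra scale N (semi_cross_product B \<alpha>)"
proof -
  obtain S q where S: "relation_space scale N S"
    and q: "algebra_presentation B q (relation_ideal scale S)" and ac: "free_acyclic scale N S"
    using B(2) unfolding koszul_algebra_iff[OF B(1)] by blast
  obtain S' a where *: "relation_space scale N S'"
    "algebra_presentation (semi_cross_product B \<alpha>) (\<lambda>x. q (twist a x)) (relation_ideal scale S')"
    "free_acyclic scale N S \<Longrightarrow> free_acyclic scale N S'"
    by (rule koszul_semi_cross_product[OF S N q \<alpha>]) (rule that; (assumption | blast))
  have "abelian_group (semi_cross_product B \<alpha>)"
    by (rule presentation.abelian_group[OF algebra_presentation.axioms(1)[OF *(2)]])
  from koszul_algebra_iff[OF this, of N] show ?thesis
    using * ac by blast
qed

end

theorem mainTheorem2: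
  fixes scale :: "'k::field \<Rightarrow> 'v::ab_group_add \<Rightarrow> 'v"
    and Basis :: "'v set"
    and N :: nat
    and R :: "('k, 'v) tensor set"
    and \<alpha> :: "('k, 'v) tensor set \<Rightarrow> ('k, 'v) tensor set"
  assumes E: "finite_dimensional_vector_space scale Basis"
    and N: "N \<ge> 2"
    and R_subspace: "linear_subspace R (tensor_algebra scale)"
    and R_degree: "R \<subseteq> tensor_power scale N"
    and \<alpha>: "\<alpha> \<in> graded_algebra_isos (homogeneous_algebra scale R) (homogeneous_algebra scale R)"
  shows "koszul_algebra scale N (homogeneous_algebra scale R) \<longleftrightarrow>
         koszul_algebra scale N (semi_cross_product (homogeneous_algebra scale R) \<alpha>)"
proof -
  interpret vector_space scale
    using E by (rule finite_dimensional_vector_space.axioms)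
  let ?A = "homogeneous_algebra scale R"
  let ?B = "semi_cross_product ?A \<alpha>"
  obtain S where S: "relation_space scale N S" and RS: "R = tensor_class scale ` S"
    by (rule relation_space_of_subspace[OF R_subspace R_degree])
  define q where "q = algebra_class scale R"
  have q: "algebra_presentation ?A q (relation_ideal scale S)"
    unfolding q_def RS by (rule algebra_presentation_homogeneous_algebra)
  obtain S' a b where S': "relation_space scale N S'"
    and q': "algebra_presentation ?B (\<lambda>x. q (twist a x)) (relation_ideal scale S')"
    and inv: "\<And>x. b (a x) = x" "\<And>x. a (b x) = x"
    and stable: "\<And>p. lmap b p \<in> relation_ideal scale S' \<longleftrightarrow> p \<in> relation_ideal scale S'"
    and ideal: "relation_ideal scale S' = {x. twist a x \<in> relation_ideal scale S}"
    by (rule koszul_semi_cross_product[OF S N q \<alpha>]) (rule that; (assumption | blast))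
  interpret A: algebra_presentation ?A q "relation_ideal scale S" by (rule q)
  interpret B: algebra_presentation ?B "\<lambda>x. q (twist a x)" "relation_ideal scale S'" by (rule q')
  have twb: "twist a (twist b p) = p" for p :: "'v list \<Rightarrow>\<^sub>0 'k"
    by (rule twist_twist[OF inv(2,1)])
  show ?thesis
  proof
    assume "koszul_algebra scale N ?A"
    then show "koszul_algebra scale N ?B"
      by (rule koszul_algebra_semi_cross_productI[OF N A.abelian_group _ \<alpha>])
  next
    assume koszul_B: "koszul_algebra scale N ?B"
    \<comment> \<open>The inverse of \<alpha> in the presentation of A^\<alpha>, as
      \<open>lmap b\<close> commutes with the twist; the choice of representative is harmless by
      \<open>stable\<close>.\<close>
    define \<beta> where "\<beta> X = q (twist a (lmap b (SOME x. q (twist a x) = X)))" for X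
    have \<beta>: "\<beta> (q (twist a x)) = q (twist a (lmap b x))" for x
    proof -
      have "q (twist a (SOME y. q (twist a y) = q (twist a x))) = q (twist a x)"
        by (rule someI_ex) blast
      then show ?thesis
        by (simp only: \<beta>_def B.q_eq_iff lmap_linear(4)[symmetric] stable)
    qed
    have \<beta>_iso: "\<beta> \<in> graded_algebra_isos ?B ?B"
      by (rule graded_algebra_isosI[OF q' B.presentation_lmap[OF inv stable] \<beta>])
    let ?C = "semi_cross_product ?B \<beta>"
    have koszul_C: "koszul_algebra scale N ?C"
      by (rule koszul_algebra_semi_cross_productI[OF N B.abelian_group koszul_B \<beta>_iso])
    \<comment> \<open>Twisting by \<open>b\<close> cancels twisting by \<open>a\<close>, so the
      double semi-cross product is presented by the original \<open>q\<close> with the original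
      kernel.\<close>
    have "algebra_presentation ?C (\<lambda>x. q (twist a (twist b x))) {x. twist b x \<in> relation_ideal scale S'}"
      by (rule algebra_presentation_semi_cross_product[where b = a, OF q' _ inv(2,1) \<beta>])
        (rule relation_ideal_homog_part(1)[OF S'])
    then have C: "algebra_presentation ?C q (relation_ideal scale S)"
      by (simp add: ideal twb)
    then interpret C: algebra_presentation ?C q "relation_ideal scale S" .
    \<comment> \<open>Equality of records would also concern products off the carrier; an
      isomorphism is enough, and both sides are presented by \<open>q\<close> with the same
      kernel.\<close>
    have id: "(\<lambda>x. x) \<in> graded_algebra_isos ?C ?A"
      by (rule graded_algebra_isosI[OF C q refl])
    show "koszul_algebra scale N ?A"
      using koszul_C isos_algebra_presentation[OF _ id A.abelian_group]
      unfolding koszul_algebra_iff[OF C.abelian_group] koszul_algebra_iff[OF A.abelian_group] by blast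
  qed
qed

end
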